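(* Let $T_0>0$, $r\ge0$, $t,z\in\mathbb R$ and let $\theta\in\mathbb R$ with $\cos\theta\ne0$. For real $\xi\ne0$ of sufficiently small absolute value put $\Phi=\xi\cos\theta$, $\phi=\xi\sin\theta$, $B=t^2\Phi^2+\left(\frac1{T_0}-i\Phi z\right)^2$ and $$\Psi=\frac1{8\pi^2}\sum_{n=1}^\infty\frac{\Phi^2}{r^2\Phi^2\sin^2\!\left(\frac{n\phi}2\right)+B\sinh^2\!\left(\frac{n\Phi}{2}\right)}.$$ Then, to all orders in $\xi$ as $\xi\to0^{\pm}$, $$\Psi\sim A(\Phi,\phi)\pm\xi\cos^2\theta\; I(\xi,\theta),$$ where $$A(\Phi,\phi)=\frac{1}{12\,(B+r^2\phi^2)}-\frac{r^2\phi^4-B\,\Phi^2}{48\pi^2\,(B+r^2\phi^2)^2}$$ is analytic in $(\Phi,\phi)$ near $(0,0)$, and $$I(\xi,\theta)=\int_0^\infty\left[\frac{1}{8\pi^2\big(B\sinh^2(\frac{y\cos\theta}2)+\Phi^2r^2\sin^2(\frac{y\sin\theta}{2})\big)}-\frac{1}{2\pi^2y^2\,(B\cos^2\theta+\Phi^2r^2\sin^2\theta)}\right]dy .$$ Discarding the last term (the one with sign depending on the side from which $\xi\to0$) and continuing $A$ to $\Phi=ia/T_0$, $\phi=i\omega/T_0$ with $a,\omega$ real and $(1+az)^2-a^2t^2-r^2\omega^2>0$ gives $$\langle:\hat\psi^2:\rangle=\frac{T_0^2}{12\,((1+az)^2-a^2t^2-r^2\omega^2)}-\frac{a^2((1+az)^2-a^2t^2)+r^2\omega^4}{48\pi^2((1+az)^2-a^2t^2-r^2\omega^2)^2}=\frac{1}{12\beta^2}+\frac{\alpha^2}{48\pi^2\beta^2},$$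 where $$\beta^2=\frac{(1+az)^2-a^2t^2-r^2\omega^2}{T_0^2},\qquad \alpha^2=-\frac{a^2((1+az)^2-a^2t^2)+r^2\omega^4}{\beta^2T_0^4}.$$
   Context: "To all orders" means that for every $N$ the difference of the two sides is $O(|\xi|^N)$ as $\xi\to0^+$ (upper sign) and as $\xi\to0^-$ (lower sign), with $\theta$ fixed. $\Psi$ is the thermal expectation value, at imaginary acceleration $a/T_0=-i\Phi$ and imaginary angular velocity $\omega/T_0=-i\phi$, of the normal ordered squared free massless neutral scalar field at the point $(t,x,y,z)$, $r^2=x^2+y^2$, in the global equilibrium state with four-temperature $\beta^\mu=\frac1{T_0}(1+az,-\omega y,\omega x,at)$, and $\langle:\hat\psi^2:\rangle$ denotes the value obtained at real $a,\omega$ by the stated procedure; $\beta^2$ and $\alpha^2$ are the Lorentz squares of $\beta^\mu$ and of $\alpha^\mu=\varpi^{\mu\nu}u_\nu$, $u=\beta/\sqrt{\beta^2}$, $\varpi$ being the thermal vorticity ($\beta_\mu=b_\mu+\varpi_{\mu\nu}x^\nu$). *)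

theory Defs
  imports "HOL-Analysis.Analysis" "HOL-Library.Landau_Symbols"
begin

section \<open>The series, the function A and the integral I\<close>

definition B_fun :: "real \<Rightarrow> real \<Rightarrow> real \<Rightarrow> complex \<Rightarrow> complex" where
  "B_fun T0 t z \<Phi> = (of_real t)\<^sup>2 * \<Phi>\<^sup>2 + (1 / of_real T0 - \<i> * \<Phi> * of_real z)\<^sup>2"

definition Psi_denom :: "real \<Rightarrow> real \<Rightarrow> real \<Rightarrow> real \<Rightarrow> real \<Rightarrow> real \<Rightarrow> nat \<Rightarrow> complex" where
  "Psi_denom T0 r t z \<Phi> \<phi> n =
     of_real (r\<^sup>2 * \<Phi>\<^sup>2 * (sin (real n * \<phi> / 2))\<^sup>2)
       + B_fun T0 t z (of_real \<Phi>) * of_real ((sinh (real n * \<Phi> / 2))\<^sup>2)"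

definition Psi_term :: "real \<Rightarrow> real \<Rightarrow> real \<Rightarrow> real \<Rightarrow> real \<Rightarrow> real \<Rightarrow> nat \<Rightarrow> complex" where
  "Psi_term T0 r t z \<Phi> \<phi> n = of_real (\<Phi>\<^sup>2) / Psi_denom T0 r t z \<Phi> \<phi> n"

definition Psi :: "real \<Rightarrow> real \<Rightarrow> real \<Rightarrow> real \<Rightarrow> real \<Rightarrow> real \<Rightarrow> complex" where
  "Psi T0 r t z \<Phi> \<phi> = of_real (1 / (8 * pi\<^sup>2)) * (\<Sum>n. Psi_term T0 r t z \<Phi> \<phi> (Suc n))"

definition A_fun :: "real \<Rightarrow> real \<Rightarrow> real \<Rightarrow> real \<Rightarrow> complex \<Rightarrow> complex \<Rightarrow> complex" where
  "A_fun T0 r t z \<Phi> \<phi> =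
     1 / (12 * (B_fun T0 t z \<Phi> + (of_real r)\<^sup>2 * \<phi>\<^sup>2))
     - ((of_real r)\<^sup>2 * \<phi> ^ 4 - B_fun T0 t z \<Phi> * \<Phi>\<^sup>2)
         / (48 * (of_real pi)\<^sup>2 * (B_fun T0 t z \<Phi> + (of_real r)\<^sup>2 * \<phi>\<^sup>2)\<^sup>2)"

definition I_denom1 :: "real \<Rightarrow> real \<Rightarrow> real \<Rightarrow> real \<Rightarrow> real \<Rightarrow> real \<Rightarrow> real \<Rightarrow> complex" where
  "I_denom1 T0 r t z \<theta> \<xi> y =
     B_fun T0 t z (of_real (\<xi> * cos \<theta>)) * of_real ((sinh (y * cos \<theta> / 2))\<^sup>2)
       + of_real ((\<xi> * cos \<theta>)\<^sup>2 * r\<^sup>2 * (sin (y * sin \<theta> / 2))\<^sup>2)"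

definition I_denom2 :: "real \<Rightarrow> real \<Rightarrow> real \<Rightarrow> real \<Rightarrow> real \<Rightarrow> real \<Rightarrow> complex" where
  "I_denom2 T0 r t z \<theta> \<xi> =
     B_fun T0 t z (of_real (\<xi> * cos \<theta>)) * of_real ((cos \<theta>)\<^sup>2)
       + of_real ((\<xi> * cos \<theta>)\<^sup>2 * r\<^sup>2 * (sin \<theta>)\<^sup>2)"

definition I_integrand :: "real \<Rightarrow> real \<Rightarrow> real \<Rightarrow> real \<Rightarrow> real \<Rightarrow> real \<Rightarrow> real \<Rightarrow> complex" where
  "I_integrand T0 r t z \<theta> \<xi> y =
     1 / (of_real (8 * pi\<^sup>2) * I_denom1 T0 r t z \<theta> \<xi> y)
     - 1 / (of_real (2 * pi\<^sup>2 * y\<^sup>2) * I_denom2 T0 r t z \<theta> \<xi>)"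

definition I_fun :: "real \<Rightarrow> real \<Rightarrow> real \<Rightarrow> real \<Rightarrow> real \<Rightarrow> real \<Rightarrow> complex" where
  "I_fun T0 r t z \<theta> \<xi> = (LBINT y:{0<..}. I_integrand T0 r t z \<theta> \<xi> y)"

section \<open>Analyticity in two complex variables and analytic continuation\<close>

definition analytic2_on :: "(complex \<times> complex \<Rightarrow> complex) \<Rightarrow> (complex \<times> complex) set \<Rightarrow> bool" where
  "analytic2_on f S \<longleftrightarrow>
     (\<forall>p\<in>S. \<exists>c :: nat \<times> nat \<Rightarrow> complex. \<exists>\<rho>>0. \<forall>h k. norm h < \<rho> \<longrightarrow> norm k < \<rho> \<longrightarrow>
        ((\<lambda>(m, n). c (m, n) * h ^ m * k ^ n) has_sum f (p + (h, k))) UNIV)"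

text \<open>\<open>v\<close> is the value at \<open>p\<close> of some analytic continuation, over a domain of
  \<open>\<complex>\<^sup>2\<close>, of the function \<open>f\<close> given for real arguments near the origin.\<close>

definition continuation_value ::
  "(real \<Rightarrow> real \<Rightarrow> complex) \<Rightarrow> complex \<times> complex \<Rightarrow> complex \<Rightarrow> bool" where
  "continuation_value f p v \<longleftrightarrow>
     (\<exists>U g. open U \<and> connected U \<and> (0, 0) \<in> U \<and> p \<in> U \<and> analytic2_on g U
        \<and> (\<exists>\<delta>>0. \<forall>\<Phi> \<phi>. \<bar>\<Phi>\<bar> < \<delta> \<longrightarrow> \<bar>\<phi>\<bar> < \<delta> \<longrightarrow> g (of_real \<Phi>, of_real \<phi>) = f \<Phi> \<phi>)
        \<and> g p = v)"

abbreviation A_real :: "real \<Rightarrow> real \<Rightarrow> real \<Rightarrow> real \<Rightarrow> real \<Rightarrow> real \<Rightarrow> complex" where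
  "A_real T0 r t z \<Phi> \<phi> \<equiv> A_fun T0 r t z (of_real \<Phi>) (of_real \<phi>)"

text \<open>The regularized expectation value: the last term of the asymptotic expansion is dropped and
  \<open>A\<close> is continued from real \<open>(\<Phi>, \<phi>)\<close> to \<open>(\<i> a / T0, \<i> \<omega> / T0)\<close>.\<close>

definition psi_sq :: "real \<Rightarrow> real \<Rightarrow> real \<Rightarrow> real \<Rightarrow> real \<Rightarrow> real \<Rightarrow> complex" where
  "psi_sq T0 r t z a \<omega> =
     (THE v. continuation_value (A_real T0 r t z) (\<i> * of_real (a / T0), \<i> * of_real (\<omega> / T0)) v)"

section \<open>Minkowski space and the equilibrium four-temperature\<close>

text \<open>Space-time indices are the elements \<open>0, 1, 2, 3\<close> of the type \<open>4\<close>, with \<open>0\<close> (which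
  coincides with \<open>4\<close>) for time; the metric has signature \<open>(+,-,-,-)\<close>.\<close>

definition vec4 :: "real \<Rightarrow> real \<Rightarrow> real \<Rightarrow> real \<Rightarrow> real ^ 4" where
  "vec4 v0 v1 v2 v3 =
     (\<chi> i. if i = 0 then v0 else if i = 1 then v1 else if i = 2 then v2 else v3)"

definition minkowski :: "real ^ 4 ^ 4" where
  "minkowski = (\<chi> i j. if i = j then (if i = 0 then 1 else - 1) else 0)"

definition lower :: "real ^ 4 \<Rightarrow> real ^ 4" where
  "lower v = minkowski *v v"

text \<open>The metric is its own inverse, so it also raises indices.\<close>

definition raise_both :: "real ^ 4 ^ 4 \<Rightarrow> real ^ 4 ^ 4" where
  "raise_both W = minkowski ** W ** minkowski"

definition lorentz_sq :: "real ^ 4 \<Rightarrow> real" where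
  "lorentz_sq v = v \<bullet> lower v"

definition four_temp :: "real \<Rightarrow> real \<Rightarrow> real \<Rightarrow> real ^ 4 \<Rightarrow> real ^ 4" where
  "four_temp T0 a \<omega> X =
     (1 / T0) *\<^sub>R vec4 (1 + a * X $ 3) (- \<omega> * X $ 2) (\<omega> * X $ 1) (a * X $ 0)"

definition thermal_vorticity :: "real \<Rightarrow> real \<Rightarrow> real \<Rightarrow> real ^ 4 ^ 4" where
  "thermal_vorticity T0 a \<omega> = (THE W. \<exists>b. \<forall>X. lower (four_temp T0 a \<omega> X) = b + W *v X)"

definition four_velocity :: "real \<Rightarrow> real \<Rightarrow> real \<Rightarrow> real ^ 4 \<Rightarrow> real ^ 4" where
  "four_velocity T0 a \<omega> X =
     (1 / sqrt (lorentz_sq (four_temp T0 a \<omega> X))) *\<^sub>R four_temp T0 a \<omega> X"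

definition alpha_vec :: "real \<Rightarrow> real \<Rightarrow> real \<Rightarrow> real ^ 4 \<Rightarrow> real ^ 4" where
  "alpha_vec T0 a \<omega> X =
     raise_both (thermal_vorticity T0 a \<omega>) *v lower (four_velocity T0 a \<omega> X)"

end

theory Submission
  imports Defs "HOL-Complex_Analysis.Complex_Analysis" "HOL-Real_Asymp.Real_Asymp"
begin

text \<open>With \<open>\<tau> = \<bar>\<xi>\<bar>\<close> the series is a trapezoidal sum of mesh \<open>\<tau>\<close> of an even meromorphic function \<open>g\<close> whose
  only singularity in a fixed strip around the real axis is a double pole at \<open>0\<close>. The pole is summed
  by \<open>\<zeta>(2) = \<pi>\<^sup>2/6\<close>. What is left is an even function \<open>h\<close>, holomorphic in the strip and \<open>O(1/y\<^sup>2)\<close>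
  there, uniformly in \<open>\<xi>\<close>, so that \<open>\<tau> (h(0)/2 + \<Sum>\<^sub>n h(n\<tau>))\<close> is the integral of \<open>h\<close> up to an error
  smaller than every power of \<open>\<tau>\<close>; the end point value \<open>h(0)\<close> gives the second term of \<open>A\<close>.

  The continuation of \<open>A\<close> exists on the complement of the zero set of its denominator, which is
  connected although the real segment from the origin to the target point may meet that zero set.
  It is unique by the identity theorem, applied on complex lines after clearing denominators.\<close>

section \<open>Trapezoidal sums of functions analytic in a strip\<close>

text \<open>The obstacle is uniformity: the function being summed changes with \<xi>, so one strip
  and one decay constant must serve all small \<xi>. They exist because B tends to 1/T0^2 while the
  weight \<Phi>^2 r^2 of the sine tends to 0; as cos \<theta> \<noteq> 0, the sinh term then
  dominates on the whole strip. The estimates are therefore made for free parameters B and e, and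
  \<xi> enters only at the end. By Cauchy's estimate every further derivative of the periodised
  function costs a constant and gains a factor \<tau>, which yields each fixed power. Both signs
  come from one estimate in |\<xi>|.

  A continuation may live on any connected open domain, even one that contains zeros of the
  denominator of A, so its uniqueness cannot be argued inside the domain of A alone. Analyticity in
  two variables means an explicit double power series; its existence for a quotient is obtained from
  an algebra of coefficient families in which a reciprocal is a Neumann series.\<close>

lemma mean_deviation_le:
  fixes g g' :: "real \<Rightarrow> complex"
  assumes "\<tau> > 0" and der: "\<And>x. x \<in> {0..\<tau>} \<Longrightarrow> (g has_vector_derivative g' x) (at x within {0..\<tau>})"
    and bd: "\<And>x. x \<in> {0..\<tau>} \<Longrightarrow> norm (g' x) \<le> M" and a: "a \<in> {0..\<tau>}"
  shows "norm (\<tau> * g a - integral {0..\<tau>} g) \<le> \<tau>\<^sup>2 * M"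
proof -
  have cont: "continuous_on {0..\<tau>} g"
    using der has_vector_derivative_continuous continuous_on_eq_continuous_within by blast
  \<comment> \<open>The mean value inequality gives one factor \<tau>, integration over a segment of
    length \<tau> the other.\<close>
  have "norm (g a - g u) \<le> M * \<tau>" if u: "u \<in> {0..\<tau>}" for u
  proof -
    have "norm (g a - g u) \<le> M * norm (a - u)"
    proof (rule differentiable_bound[of "{0..\<tau>}" g "\<lambda>x h. h *\<^sub>R g' x"])
      show "onorm (\<lambda>h. h *\<^sub>R g' x) \<le> M" if "x \<in> {0..\<tau>}" for x
        using bd[OF that] by (simp add: onorm_scaleR_left onorm_id)
    qed (use der u a in \<open>auto simp: has_vector_derivative_def\<close>)
    also have "\<dots> \<le> M * \<tau>"
      using u a order_trans[OF norm_ge_zero bd[OF a]] by (intro mult_left_mono) (auto simp: abs_le_iff)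
    finally show ?thesis .
  qed
  then have "norm (integral {0..\<tau>} (\<lambda>u. g a - g u)) \<le> M * \<tau> * (\<tau> - 0)"
    using \<open>\<tau> > 0\<close> cont by (intro integral_bound continuous_intros) auto
  moreover have "integral {0..\<tau>} (\<lambda>u. g a - g u) = \<tau> * g a - integral {0..\<tau>} g"
    using \<open>\<tau> > 0\<close> cont
    by (subst integral_diff) (auto intro!: integrable_continuous_real simp: scaleR_conv_of_real)
  ultimately show ?thesis by (simp add: power2_eq_square mult.commute mult.left_commute)
qed

lemma higher_deriv_has_vector_derivative:
  assumes "f holomorphic_on S" "open S" "complex_of_real x \<in> S"
  shows "((\<lambda>x. (deriv ^^ k) f (complex_of_real x)) has_vector_derivative
          (deriv ^^ Suc k) f (complex_of_real x)) (at x within A)"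
proof -
  have "((deriv ^^ k) f has_field_derivative (deriv ^^ Suc k) f (complex_of_real x)) (at (complex_of_real x))"
    using holomorphic_derivI[OF holomorphic_higher_deriv[OF assms(1,2)] assms(2,3)] by simp
  then show ?thesis
    by (rule has_vector_derivative_at_within[OF has_vector_derivative_real_field])
qed

text \<open>The positive derivatives of a periodic function have mean zero, so that each of them is
  bounded by \<open>\<tau>\<close> times the next one.\<close>

lemma periodic_mean_deviation:
  fixes F :: "complex \<Rightarrow> complex"
  assumes holo: "F holomorphic_on S" and S: "open S" and \<tau>: "0 < \<tau>"
    and seg: "complex_of_real ` {0..\<tau>} \<subseteq> S"
    and per: "\<And>k. (deriv ^^ k) F (of_real \<tau>) = (deriv ^^ k) F 0"
    and bd: "\<And>x. x \<in> {0..\<tau>} \<Longrightarrow> norm ((deriv ^^ Suc N) F (of_real x)) \<le> M"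
    and a: "a \<in> {0..\<tau>}"
  shows "norm (\<tau> * F (of_real a) - integral {0..\<tau>} (\<lambda>u. F (of_real u))) \<le> \<tau> ^ (N + 2) * M"
  using bd
proof (induction N arbitrary: M)
  case 0
  have "norm (\<tau> * (deriv ^^ 0) F (of_real a) - integral {0..\<tau>} (\<lambda>u. (deriv ^^ 0) F (of_real u))) \<le> \<tau>\<^sup>2 * M"
    by (rule mean_deviation_le[OF \<tau> higher_deriv_has_vector_derivative[OF holo S]])
       (use 0 seg a in auto)
  then show ?case by (simp add: power2_eq_square mult.assoc)
next
  case (Suc N)
  have "norm ((deriv ^^ Suc N) F (of_real x)) \<le> \<tau> * M" if x: "x \<in> {0..\<tau>}" for x
  proof -
    have "norm (\<tau> * (deriv ^^ Suc N) F (of_real x) - integral {0..\<tau>} (\<lambda>u. (deriv ^^ Suc N) F (of_real u))) \<le> \<tau>\<^sup>2 * M"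
      by (rule mean_deviation_le[OF \<tau> higher_deriv_has_vector_derivative[OF holo S]])
         (use Suc.prems seg x in auto)
    \<comment> \<open>The integral drops out because the end values of the derivative one order
      lower agree by \<open>per\<close>.\<close>
    moreover have "((\<lambda>u. (deriv ^^ Suc N) F (of_real u)) has_integral
        (deriv ^^ N) F (of_real \<tau>) - (deriv ^^ N) F (of_real 0)) {0..\<tau>}"
      by (rule fundamental_theorem_of_calculus[OF _ higher_deriv_has_vector_derivative[OF holo S]])
         (use \<tau> seg in auto)
    then have "integral {0..\<tau>} (\<lambda>u. (deriv ^^ Suc N) F (of_real u)) = 0"
      using per[of N] by (simp add: integral_unique)
    ultimately have "\<tau> * norm ((deriv ^^ Suc N) F (of_real x)) \<le> \<tau> * (\<tau> * M)"
      using \<tau> by (simp add: norm_mult power2_eq_square mult.assoc)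
    then show ?thesis using \<tau> by simp
  qed
  from Suc.IH[OF this] show ?case by (simp add: algebra_simps)
qed

text \<open>With half-width 1 and |c|, |s| \<le> 1, the imaginary parts of c w / 2 and s w / 2 stay
  below 1/2, where the elementary bounds for sin and sinh hold and sinh vanishes only at 0.\<close>

definition unit_strip :: "complex set" where "unit_strip = {w. \<bar>Im w\<bar> < 1}"

lemma open_unit_strip: "open unit_strip"
  unfolding unit_strip_def by (intro open_Collect_less continuous_intros)

lemma convex_unit_strip: "convex unit_strip"
proof -
  have "unit_strip = {w. Im w < 1} \<inter> {w. Im w > -1}"
    by (auto simp: unit_strip_def)
  show ?thesis unfolding \<open>unit_strip = _\<close> by (intro convex_Int convex_halfspace_Im_lt convex_halfspace_Im_gt)
qed

text \<open>Majorises the decay 1/(1+x^2) of all translates at once, for base points in a bounded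
  set. The loss of 1/\<tau>^2 is harmless since the final power of \<tau> is arbitrary. Allowing any
  m \<ge> n covers the shifts by n and by n+1.\<close>

lemma inverse_square_shift_bound:
  fixes x \<tau> :: real
  assumes "\<bar>x\<bar> \<le> 2" "0 < \<tau>" "\<tau> \<le> 1" "m \<ge> real n"
  shows "1 / (1 + (x + m * \<tau>)\<^sup>2) \<le> 9 / \<tau>\<^sup>2 / (1 + (real n)\<^sup>2)"
    and "1 / (1 + (x - m * \<tau>)\<^sup>2) \<le> 9 / \<tau>\<^sup>2 / (1 + (real n)\<^sup>2)"
proof -
  have *: "1 / (1 + (x + s * m * \<tau>)\<^sup>2) \<le> 9 / \<tau>\<^sup>2 / (1 + (real n)\<^sup>2)" if s: "s\<^sup>2 = 1" for s
  proof -
    have "\<tau>\<^sup>2 * (1 + (real n)\<^sup>2) \<le> 1 + (m * \<tau>)\<^sup>2"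
    proof -
      have "\<tau>\<^sup>2 \<le> 1" using assms by (simp add: power_le_one)
      moreover have "(real n)\<^sup>2 \<le> m\<^sup>2" using assms by (intro power_mono) auto
      then have "(real n)\<^sup>2 * \<tau>\<^sup>2 \<le> m\<^sup>2 * \<tau>\<^sup>2" by (intro mult_right_mono) auto
      ultimately show ?thesis by (simp add: algebra_simps power_mult_distrib)
    qed
    \<comment> \<open>With Y the squared shifted argument, (m \<tau>)^2 \<le> 2 Y + 2 x^2 \<le> 2 Y
      + 8, whence 9 = 1 + 8.\<close>
    also have "\<dots> \<le> 9 * (1 + (x + s * m * \<tau>)\<^sup>2)"
    proof -
      have "(m * \<tau>)\<^sup>2 = (s * m * \<tau>)\<^sup>2" using s by (simp add: power_mult_distrib)
      also have "\<dots> \<le> 2 * (x + s * m * \<tau>)\<^sup>2 + 2 * x\<^sup>2"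
        using zero_le_power2[of "2 * x + s * m * \<tau>"] by (simp add: power2_eq_square algebra_simps)
      also have "x\<^sup>2 \<le> 2\<^sup>2" using assms(1) by (metis abs_ge_zero power2_abs power_mono)
      finally have "(m * \<tau>)\<^sup>2 \<le> 2 * (x + s * m * \<tau>)\<^sup>2 + 2 * 2\<^sup>2" by simp
      moreover have "A \<le> 2 * Y + 2 * 2\<^sup>2 \<Longrightarrow> 0 \<le> Y \<Longrightarrow> 1 + A \<le> 9 * (1 + Y)" for A Y :: real by simp
      ultimately show ?thesis using zero_le_power2 by blast
    qed
    finally show ?thesis using \<open>0 < \<tau>\<close>
      by (simp add: field_simps add_pos_nonneg)
  qed
  from *[of 1] *[of "-1"]
  show "1 / (1 + (x + m * \<tau>)\<^sup>2) \<le> 9 / \<tau>\<^sup>2 / (1 + (real n)\<^sup>2)"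
    and "1 / (1 + (x - m * \<tau>)\<^sup>2) \<le> 9 / \<tau>\<^sup>2 / (1 + (real n)\<^sup>2)" by auto
qed

lemma summable_inverse_1_plus_square: "summable (\<lambda>n. 1 / (1 + (real n)\<^sup>2))"
proof (rule summable_comparison_test')
  show "summable (\<lambda>n. 1 / (real n)\<^sup>2)"
    using inverse_power_summable[of 2, where 'a = real] by (simp add: field_simps)
  show "norm (1 / (1 + (real n)\<^sup>2)) \<le> 1 / (real n)\<^sup>2" if "n \<ge> 1" for n
    using that by (simp add: frac_le)
qed

lemma set_integrable_inverse_1_plus_square: "set_integrable lborel {0<..} (\<lambda>x::real. 1 / (1 + x\<^sup>2))"
proof -
  have "set_integrable lborel (einterval 0 \<infinity>) (\<lambda>x::real. 1 / (1 + x\<^sup>2))"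
  proof (rule interval_integral_FTC_nonneg(1)[where F = arctan and A = 0 and B = "pi/2"])
    show "((arctan \<circ> real_of_ereal) \<longlongrightarrow> 0) (at_right 0)"
      by (simp add: zero_ereal_def ereal_tendsto_simps) (metis arctan_zero_zero continuous_arctan isCont_arctan filterlim_at_split isCont_def)
    show "((arctan \<circ> real_of_ereal) \<longlongrightarrow> pi/2) (at_left \<infinity>)"
      by (simp add: ereal_tendsto_simps tendsto_arctan_at_top)
  qed (auto intro!: derivative_eq_intros continuous_intros AE_I2 simp: add_nonneg_eq_0_iff inverse_eq_divide zero_ereal_def)
  moreover have "einterval 0 \<infinity> = {0<..}" by (auto simp: einterval_def zero_ereal_def)
  ultimately show ?thesis by simp
qed

text \<open>In the Euler-Maclaurin expansion of an even function all boundary terms but the first vanish. Here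
  this is obtained without Bernoulli numbers, because the sum over all translates is periodic.\<close>

lemma strip_sum_integral_bound:
  fixes h :: "complex \<Rightarrow> complex"
  assumes holo: "h holomorphic_on unit_strip"
    and bd: "\<And>w. w \<in> unit_strip \<Longrightarrow> norm (h w) \<le> C / (1 + (Re w)\<^sup>2)"
    and even: "\<And>w. w \<in> unit_strip \<Longrightarrow> h (- w) = h w"
    and \<tau>: "0 < \<tau>" "\<tau> \<le> 1"
  defines "\<kappa> \<equiv> (\<Sum>n. 1 / (1 + (real n)\<^sup>2))"
  shows "set_integrable lborel {0<..} (\<lambda>y. h (of_real y))"
    and "summable (\<lambda>n. h (of_real (real (Suc n) * \<tau>)))"
    and "norm (\<tau> * (h 0 + 2 * (\<Sum>n. h (of_real (real (Suc n) * \<tau>)))) - 2 * (LBINT y:{0<..}. h (of_real y)))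
          \<le> 18 * C * \<kappa> * fact (N + 3) * 2 ^ (N + 3) * \<tau> ^ (N + 2)"
proof -
  have real_in: "complex_of_real x \<in> unit_strip" for x by (simp add: unit_strip_def)
  have C0: "C \<ge> 0" using order_trans[OF norm_ge_zero bd[OF real_in[of 0]]] by simp
  have conth: "continuous_on A (\<lambda>y. h (of_real y))" for A
    by (rule continuous_on_compose2[OF holomorphic_on_imp_continuous_on[OF holo]])
       (auto intro!: continuous_intros real_in)
  have int: "set_integrable lborel {0<..} (\<lambda>y. h (of_real y))"
  proof (rule set_integrable_bound[where f = "\<lambda>x. C * (1 / (1 + x\<^sup>2))"])
    show "set_integrable lborel {0<..} (\<lambda>x. C * (1 / (1 + x\<^sup>2)))"
      using set_integrable_inverse_1_plus_square by (intro set_integrable_mult_right) auto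
    show "set_borel_measurable lborel {0<..} (\<lambda>y. h (complex_of_real y))"
      using borel_measurable_continuous_on_indicator[OF _ conth, of "{0<..}"]
      by (simp add: set_borel_measurable_def)
    show "AE x in lborel. x \<in> {0<..} \<longrightarrow> cmod (h (complex_of_real x)) \<le> norm (C * (1 / (1 + x\<^sup>2)))"
      using bd[OF real_in] C0 by (intro AE_I2) (simp add: abs_mult)
  qed
  show "set_integrable lborel {0<..} (\<lambda>y. h (of_real y))" by (rule int)

  \<comment> \<open>Each \<open>T n\<close> below consists of two translates, each majorised with
    the constant 9.\<close>
  define K where "K = (\<lambda>n. 18 * C / \<tau>\<^sup>2 * (1 / (1 + (real n)\<^sup>2)))"
  have sumK: "summable K" unfolding K_def by (intro summable_mult summable_inverse_1_plus_square)
  \<comment> \<open>A bounded real part makes the majorant uniform; the bound 2 leaves room for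
    discs of radius 1/2 around every point of [0, \<tau>].\<close>
  define S where "S = unit_strip \<inter> {w. \<bar>Re w\<bar> < 2}"
  have oS: "open S" unfolding S_def
    by (intro open_Int open_unit_strip open_Collect_less continuous_intros)
  \<comment> \<open>Pairing the shift by n with the shift by -(n+1) lists every integer shift
    exactly once, so \<open>F\<close> below is the periodisation of \<open>h\<close>.\<close>
  define T where "T = (\<lambda>n w. h (w + of_real (real n * \<tau>)) + h (w - of_real (real (Suc n) * \<tau>)))"
  have T_bound: "norm (T n w) \<le> K n" if "w \<in> S" for n w
  proof -
    have w: "w + of_real x \<in> unit_strip" "w - of_real x \<in> unit_strip" for x
      using that by (auto simp: S_def unit_strip_def)
    have Rw: "\<bar>Re w\<bar> \<le> 2" using that by (simp add: S_def)
    have "norm (h (w + of_real (real n * \<tau>))) \<le> C * (1 / (1 + (Re w + real n * \<tau>)\<^sup>2))"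
      using bd[OF w(1)[of "real n * \<tau>"]] by simp
    also have "\<dots> \<le> C * (9 / \<tau>\<^sup>2 / (1 + (real n)\<^sup>2))"
      by (rule mult_left_mono[OF inverse_square_shift_bound(1)[OF Rw \<tau>] C0]) simp
    finally have 1: "norm (h (w + of_real (real n * \<tau>))) \<le> C * (9 / \<tau>\<^sup>2 / (1 + (real n)\<^sup>2))" .
    have "norm (h (w - of_real (real (Suc n) * \<tau>))) \<le> C * (1 / (1 + (Re w - real (Suc n) * \<tau>)\<^sup>2))"
      using bd[OF w(2)[of "real (Suc n) * \<tau>"]] by simp
    also have "\<dots> \<le> C * (9 / \<tau>\<^sup>2 / (1 + (real n)\<^sup>2))"
      by (rule mult_left_mono[OF inverse_square_shift_bound(2)[OF Rw \<tau>] C0]) simp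
    finally have 2: "norm (h (w - of_real (real (Suc n) * \<tau>))) \<le> C * (9 / \<tau>\<^sup>2 / (1 + (real n)\<^sup>2))" .
    have "norm (T n w) \<le> C * (9 / \<tau>\<^sup>2 / (1 + (real n)\<^sup>2)) + C * (9 / \<tau>\<^sup>2 / (1 + (real n)\<^sup>2))"
      unfolding T_def by (intro order_trans[OF norm_triangle_ineq] add_mono 1 2)
    also have "\<dots> = K n" by (simp add: K_def)
    finally show ?thesis .
  qed
  define F where "F = (\<lambda>w. \<Sum>n. T n w)"
  have T_summable: "summable (\<lambda>n. T n w)" if "w \<in> S" for w
    using summable_comparison_test'[OF sumK T_bound[OF that]] .
  have F_bound: "norm (F w) \<le> 18 * C / \<tau>\<^sup>2 * \<kappa>" if "w \<in> S" for w
  proof -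
    have "norm (F w) \<le> suminf K"
      unfolding F_def by (rule norm_suminf_le[OF T_bound[OF that] sumK])
    also have "\<dots> = 18 * C / \<tau>\<^sup>2 * \<kappa>"
      unfolding K_def \<kappa>_def by (rule suminf_mult[OF summable_inverse_1_plus_square])
    finally show ?thesis .
  qed
  have ulim: "uniform_limit S (\<lambda>M w. \<Sum>n<M. T n w) F sequentially"
    unfolding F_def by (rule Weierstrass_m_test[OF T_bound sumK])
  have T_holo: "T n holomorphic_on S" for n
    unfolding T_def
    by (intro holomorphic_on_add holomorphic_on_compose_gen[OF _ holo, unfolded o_def] holomorphic_intros)
       (auto simp: S_def unit_strip_def)
  have F_holo: "F holomorphic_on S"
  proof (rule holomorphic_uniform_sequence[OF oS])
    show "(\<lambda>w. \<Sum>n<M. T n w) holomorphic_on S" for M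
      by (intro holomorphic_on_sum T_holo)
    fix x assume "x \<in> S"
    then obtain d where "d > 0" "cball x d \<subseteq> S"
      using oS open_contains_cball by blast
    then show "\<exists>d>0. cball x d \<subseteq> S \<and> uniform_limit (cball x d) (\<lambda>M w. \<Sum>n<M. T n w) F sequentially"
      using uniform_limit_on_subset[OF ulim] by blast
  qed
  have h_lim: "(\<lambda>M. h (w + of_real (s * (real M * \<tau>)))) \<longlonglongrightarrow> 0" if w: "w \<in> unit_strip" and s: "s\<^sup>2 = 1" for w s
  proof (rule Lim_null_comparison)
    have "norm (h (w + of_real (s * (real M * \<tau>)))) \<le> C / (1 + (Re w + s * (real M * \<tau>))\<^sup>2)" for M
      using bd[of "w + of_real (s * (real M * \<tau>))"] w by (simp add: unit_strip_def)
    then show "\<forall>\<^sub>F M in sequentially. norm (h (w + of_real (s * (real M * \<tau>)))) \<le> C / (1 + (Re w + s * (real M * \<tau>))\<^sup>2)"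
      by simp
    have "s = 1 \<or> s = -1" using s by (simp add: power2_eq_1_iff)
    then show "(\<lambda>M. C / (1 + (Re w + s * (real M * \<tau>))\<^sup>2)) \<longlonglongrightarrow> 0"
      using \<tau> by (elim disjE; simp; real_asymp)
  qed
  have F_per: "F (w + of_real \<tau>) = F w" if w: "w \<in> S" and w': "w + of_real \<tau> \<in> S" for w
  proof -
    \<comment> \<open>The difference telescopes: only the two outermost translates survive, and both
      tend to 0.\<close>
    have "(\<Sum>n<M. T n (w + of_real \<tau>)) - (\<Sum>n<M. T n w) =
        h (w + of_real (1 * (real M * \<tau>))) - h (w + of_real (- 1 * (real M * \<tau>)))" for M
      by (induction M) (simp_all add: T_def algebra_simps)
    moreover have "(\<lambda>M. h (w + of_real (1 * (real M * \<tau>))) - h (w + of_real (- 1 * (real M * \<tau>)))) \<longlonglongrightarrow> 0 - 0"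
      by (intro tendsto_diff h_lim) (use w in \<open>auto simp: S_def\<close>)
    ultimately have "(\<lambda>M. (\<Sum>n<M. T n (w + of_real \<tau>)) - (\<Sum>n<M. T n w)) \<longlonglongrightarrow> 0" by simp
    moreover have "(\<lambda>M. (\<Sum>n<M. T n (w + of_real \<tau>)) - (\<Sum>n<M. T n w)) \<longlonglongrightarrow> F (w + of_real \<tau>) - F w"
      unfolding F_def by (intro tendsto_diff summable_LIMSEQ T_summable w w')
    ultimately show ?thesis using LIMSEQ_unique by fastforce
  qed
  have seg_S: "complex_of_real ` {0..\<tau>} \<subseteq> S" using \<tau> by (auto simp: S_def unit_strip_def)
  \<comment> \<open>Periodicity is known only between points of \<open>S\<close>; a disc of radius
    1/2 around 0 and its shift by \<tau> both lie there, which suffices for the derivatives at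
    0.\<close>
  have per0: "(deriv ^^ k) F (of_real \<tau>) = (deriv ^^ k) F 0" for k
  proof -
    have b: "w \<in> S" "w + of_real \<tau> \<in> S" if "w \<in> ball 0 (1/2)" for w
      using that \<tau> abs_Re_le_cmod[of w] abs_Im_le_cmod[of w] by (auto simp: S_def unit_strip_def)
    have "(deriv ^^ k) (\<lambda>w. F (1 * w + of_real \<tau>)) 0 = 1 ^ k * (deriv ^^ k) F (1 * 0 + of_real \<tau>)"
      by (rule higher_deriv_compose_linear'[OF F_holo, of "ball 0 (1/2)"]) (use oS b in auto)
    moreover have "(deriv ^^ k) (\<lambda>w. F (1 * w + of_real \<tau>)) 0 = (deriv ^^ k) F 0"
    proof (rule higher_deriv_transform_within_open[of _ "ball 0 (1/2)"])
      show "(\<lambda>w. F (1 * w + of_real \<tau>)) holomorphic_on ball 0 (1/2)"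
        by (rule holomorphic_on_compose_gen[OF _ F_holo, unfolded o_def])
           (use b in \<open>auto intro!: holomorphic_intros\<close>)
      show "F holomorphic_on ball 0 (1/2)"
        by (rule holomorphic_on_subset[OF F_holo]) (use b in auto)
    qed (use b F_per in auto)
    ultimately show ?thesis by simp
  qed
  \<comment> \<open>Cauchy's bound for the derivative of order N+3 on discs of radius 1/2. The bound
    on \<open>F\<close> contains 1/\<tau>^2, so the deviation lemma is used with N+2: of
    \<tau>^(N+4) there remains \<tau>^(N+2).\<close>
  define B where "B = fact (N + 3) * (18 * C / \<tau>\<^sup>2 * \<kappa>) / (1/2) ^ (N + 3)"
  have dev: "norm (\<tau> * F (of_real 0) - integral {0..\<tau>} (\<lambda>u. F (of_real u))) \<le> \<tau> ^ (N + 2 + 2) * B"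
  proof (rule periodic_mean_deviation[OF F_holo oS \<tau>(1) seg_S per0])
    fix x assume x: "x \<in> {0..\<tau>}"
    have sub: "cball (complex_of_real x) (1/2) \<subseteq> S"
    proof
      fix w assume "w \<in> cball (complex_of_real x) (1/2)"
      then have "norm (w - of_real x) \<le> 1/2" by (simp add: dist_norm norm_minus_commute)
      then show "w \<in> S"
        using x \<tau> abs_Re_le_cmod[of "w - of_real x"] abs_Im_le_cmod[of "w - of_real x"]
        by (auto simp: S_def unit_strip_def)
    qed
    have "norm ((deriv ^^ (N + 3)) F (of_real x)) \<le> B"
      unfolding B_def
    proof (rule Cauchy_inequality)
      show "F holomorphic_on ball (complex_of_real x) (1/2)"
        using sub ball_subset_cball by (blast intro: holomorphic_on_subset[OF F_holo])
      show "continuous_on (cball (complex_of_real x) (1/2)) F"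
        using sub continuous_on_subset holomorphic_on_imp_continuous_on[OF F_holo] by blast
      show "norm (F w) \<le> 18 * C / \<tau>\<^sup>2 * \<kappa>" if "norm (of_real x - w) = 1/2" for w
        using that sub by (intro F_bound) (auto simp: dist_norm)
    qed simp
    then show "norm ((deriv ^^ Suc (N + 2)) F (of_real x)) \<le> B"
      by (simp add: eval_nat_numeral)
  qed (use \<tau> in auto)
  have B_eq: "\<tau> ^ (N + 2 + 2) * B = 18 * C * \<kappa> * fact (N + 3) * 2 ^ (N + 3) * \<tau> ^ (N + 2)"
    using \<tau> by (simp add: B_def power_add power_one_over field_simps power2_eq_square)

  \<comment> \<open>A primitive on the convex strip turns the integrals of shifted (s = 1) and
    reflected (s = -1) copies of \<open>h\<close> into differences of its values.\<close>
  obtain P where P: "\<And>x. x \<in> unit_strip \<Longrightarrow> (P has_field_derivative h x) (at x within unit_strip)"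
    using holomorphic_convex_primitive'[OF convex_unit_strip open_unit_strip holo] by blast
  have P_FTC: "((\<lambda>u. h (of_real (s * u + c))) has_integral s * (P (of_real (s * b + c)) - P (of_real (s * a + c)))) {a..b}"
    if "a \<le> b" "s\<^sup>2 = 1" for a b c s
  proof -
    have "((\<lambda>u. P (of_real (s * u + c))) has_vector_derivative s * h (of_real (s * x + c))) (at x within {a..b})" for x
    proof -
      have "(P has_field_derivative h (of_real (s * x + c))) (at (of_real (s * x + c)))"
        using P[OF real_in] at_within_open[OF real_in open_unit_strip] by metis
      then have "((\<lambda>z. P (of_real s * z + of_real c)) has_field_derivative h (of_real (s * x + c)) * of_real s) (at (of_real x))"
        by (intro DERIV_chain2[where f = P]) (auto intro!: derivative_eq_intros)
      from has_vector_derivative_at_within[OF has_vector_derivative_real_field[OF this]]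
      show ?thesis by (simp add: mult.commute)
    qed
    then have "((\<lambda>u. s * h (of_real (s * u + c))) has_integral P (of_real (s * b + c)) - P (of_real (s * a + c))) {a..b}"
      by (intro fundamental_theorem_of_calculus that) auto
    from has_integral_mult_right[OF this, of s]
    have "((\<lambda>u. s\<^sup>2 * h (of_real (s * u + c))) has_integral s * (P (of_real (s * b + c)) - P (of_real (s * a + c)))) {a..b}"
      by (simp add: power2_eq_square algebra_simps)
    moreover have "(complex_of_real s)\<^sup>2 = 1" using that(2) by (metis of_real_1 of_real_power)
    ultimately show ?thesis by simp
  qed
  \<comment> \<open>The integral covers [n \<tau>, (n+1) \<tau>] and its mirror image; written as
    the increment in n of P(n \<tau>) - P(-n \<tau>), it telescopes.\<close>
  have T_int: "((\<lambda>u. T n (of_real u)) has_integral (P (of_real (real (Suc n) * \<tau>)) - P (of_real (- real (Suc n) * \<tau>)))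
       - (P (of_real (real n * \<tau>)) - P (of_real (- real n * \<tau>)))) {0..\<tau>}" for n
    using has_integral_add[OF P_FTC[of 0 \<tau> 1 "real n * \<tau>"] P_FTC[of 0 \<tau> 1 "- real (Suc n) * \<tau>"]] \<tau>
    by (simp add: T_def algebra_simps)
  have S_int: "((\<lambda>u. \<Sum>n<M. T n (of_real u)) has_integral P (of_real (real M * \<tau>)) - P (of_real (- real M * \<tau>))) {0..\<tau>}" for M
  proof -
    have "((\<lambda>u. \<Sum>n<M. T n (of_real u)) has_integral (\<Sum>n<M. (P (of_real (real (Suc n) * \<tau>)) - P (of_real (- real (Suc n) * \<tau>)))
       - (P (of_real (real n * \<tau>)) - P (of_real (- real n * \<tau>))))) {0..\<tau>}"
      by (intro has_integral_sum T_int) simp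
    also have "(\<Sum>n<M. (P (of_real (real (Suc n) * \<tau>)) - P (of_real (- real (Suc n) * \<tau>)))
       - (P (of_real (real n * \<tau>)) - P (of_real (- real n * \<tau>)))) = P (of_real (real M * \<tau>)) - P (of_real (- real M * \<tau>))"
      by (subst sum_lessThan_telescope) simp
    finally show ?thesis .
  qed
  have half: "P (of_real b) - P (of_real (- b)) = 2 * (LBINT y:{0..b}. h (of_real y))" if "b \<ge> 0" for b
  proof -
    have 1: "((\<lambda>u. h (of_real u)) has_integral P (of_real b) - P 0) {0..b}"
      using P_FTC[of 0 b 1 0] that by simp
    have "((\<lambda>u. h (of_real (- u))) has_integral P 0 - P (of_real (-b))) {0..b}"
      using P_FTC[of 0 b "-1" 0] that by simp
    moreover have "h (of_real (- u)) = h (of_real u)" for u using even[OF real_in] by simp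
    ultimately have 2: "((\<lambda>u. h (of_real u)) has_integral P 0 - P (of_real (-b))) {0..b}" by simp
    have "set_integrable lborel {0..b} (\<lambda>y. h (of_real y))"
      unfolding set_integrable_def by (rule borel_integrable_compact[OF compact_Icc conth])
    from set_borel_integral_eq_integral(2)[OF this]
    have "(LBINT y:{0..b}. h (of_real y)) = integral {0..b} (\<lambda>u. h (of_real u))" .
    with 1 2 show ?thesis by (metis (no_types, lifting) diff_add_cancel diff_add_eq has_integral_unique integral_unique mult_2 add_diff_eq)
  qed
  have tail: "(\<lambda>M. LBINT y:{0..real M * \<tau>}. h (of_real y)) \<longlonglongrightarrow> (LBINT y:{0<..}. h (of_real y))"
  proof -
    \<comment> \<open>The limit is taken over the closed half-line, while the claim concerns the
      open one; they differ by the null set {0}.\<close>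
    have AE: "AE x in lborel. x \<in> {0<..} \<longleftrightarrow> x \<in> {0::real..}"
      using AE_lborel_singleton[of "0::real"] by eventually_elim auto
    have "set_integrable lborel {0..} (\<lambda>y. h (of_real y))"
    proof -
      have "set_integrable lborel ({0<..} \<union> {0::real}) (\<lambda>y. h (of_real y))"
        by (rule set_integrable_Un[OF int])
           (auto simp: set_integrable_def intro!: borel_integrable_compact conth)
      also have "{0<..} \<union> {0::real} = {0..}" by auto
      finally show ?thesis .
    qed
    then have "((\<lambda>b. LBINT y:{0..b}. h (of_real y)) \<longlongrightarrow> (LBINT y:{0..}. h (of_real y))) at_top"
      by (intro tendsto_set_lebesgue_integral_at_top) auto
    moreover have "filterlim (\<lambda>M. real M * \<tau>) at_top sequentially"
      using \<tau> by real_asymp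
    moreover have "(LBINT y:{0..}. h (of_real y)) = (LBINT y:{0<..}. h (of_real y))"
      by (rule set_integral_cong_set[OF _ _ AE])
         (auto simp: set_borel_measurable_def intro!: borel_measurable_continuous_on_indicator conth)
    ultimately show ?thesis by (auto intro: filterlim_compose)
  qed
  have F_int: "integral {0..\<tau>} (\<lambda>u. F (of_real u)) = 2 * (LBINT y:{0<..}. h (of_real y))"
  proof -
    have "uniform_limit {0..\<tau>} (\<lambda>M u. \<Sum>n<M. T n (of_real u)) (\<lambda>u. F (of_real u)) sequentially"
      by (rule uniform_limit_compose'[OF ulim]) (use seg_S in auto)
    moreover have "continuous_on {0..\<tau>} (\<lambda>u. \<Sum>n<M. T n (of_real u))" for M
      using seg_S
      by (intro continuous_on_sum continuous_on_compose2[OF holomorphic_on_imp_continuous_on[OF T_holo]] continuous_intros)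
    ultimately obtain I J where IJ: "\<And>M. ((\<lambda>u. \<Sum>n<M. T n (of_real u)) has_integral I M) {0..\<tau>}"
      "((\<lambda>u. F (of_real u)) has_integral J) {0..\<tau>}" "I \<longlonglongrightarrow> J"
      by (rule uniform_limit_integral) auto
    then have "(\<lambda>M. integral {0..\<tau>} (\<lambda>u. \<Sum>n<M. T n (of_real u))) \<longlonglongrightarrow> integral {0..\<tau>} (\<lambda>u. F (of_real u))"
      unfolding integral_unique[OF IJ(1)] integral_unique[OF IJ(2)] by simp
    moreover have "integral {0..\<tau>} (\<lambda>u. \<Sum>n<M. T n (of_real u)) = 2 * (LBINT y:{0..real M * \<tau>}. h (of_real y))" for M
      using integral_unique[OF S_int] half[of "real M * \<tau>"] \<tau> by simp
    ultimately have "(\<lambda>M. 2 * (LBINT y:{0..real M * \<tau>}. h (of_real y))) \<longlonglongrightarrow> integral {0..\<tau>} (\<lambda>u. F (of_real u))"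
      by simp
    moreover have "(\<lambda>M. 2 * (LBINT y:{0..real M * \<tau>}. h (of_real y))) \<longlonglongrightarrow> 2 * (LBINT y:{0<..}. h (of_real y))"
      by (intro tendsto_intros tail)
    ultimately show ?thesis by (rule LIMSEQ_unique)
  qed
  have summ: "summable (\<lambda>n. h (of_real (real n * \<tau>)))"
  proof (rule summable_comparison_test'[OF sumK])
    fix n
    have "norm (h (of_real (real n * \<tau>))) \<le> C * (1 / (1 + (0 + real n * \<tau>)\<^sup>2))"
      using bd[OF real_in[of "real n * \<tau>"]] by simp
    also have "\<dots> \<le> C * (9 / \<tau>\<^sup>2 / (1 + (real n)\<^sup>2))"
      by (rule mult_left_mono[OF inverse_square_shift_bound(1)[OF _ \<tau>] C0]) simp_all
    also have "\<dots> = K n / 2" by (simp add: K_def)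
    also have "\<dots> \<le> K n"
    proof -
      have "0 \<le> K n" using C0 by (simp add: K_def)
      then show ?thesis by simp
    qed
    finally show "norm (h (of_real (real n * \<tau>))) \<le> K n" .
  qed
  then show summ': "summable (\<lambda>n. h (of_real (real (Suc n) * \<tau>)))"
    by (subst summable_Suc_iff)
  \<comment> \<open>By evenness the negative shifts repeat the positive ones; only the shift by 0 is
    counted once.\<close>
  have "F (of_real 0) = h 0 + 2 * (\<Sum>n. h (of_real (real (Suc n) * \<tau>)))"
  proof -
    have "T n 0 = h (of_real (real n * \<tau>)) + h (of_real (real (Suc n) * \<tau>))" for n
      using even[OF real_in[of "real (Suc n) * \<tau>"]] by (simp add: T_def)
    then have "F (of_real 0) = (\<Sum>n. h (of_real (real n * \<tau>))) + (\<Sum>n. h (of_real (real (Suc n) * \<tau>)))"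
      using suminf_add[OF summ summ'] by (simp add: F_def)
    also have "(\<Sum>n. h (of_real (real n * \<tau>))) = h 0 + (\<Sum>n. h (of_real (real (Suc n) * \<tau>)))"
      using suminf_split_head[OF summ] by simp
    finally show ?thesis by simp
  qed
  with dev show "norm (\<tau> * (h 0 + 2 * (\<Sum>n. h (of_real (real (Suc n) * \<tau>)))) - 2 * (LBINT y:{0<..}. h (of_real y)))
          \<le> 18 * C * \<kappa> * fact (N + 3) * 2 ^ (N + 3) * \<tau> ^ (N + 2)"
    unfolding F_int B_eq by simp
qed

section \<open>The kernel of the series\<close>

lemma norm_sin_squared_eq: "(norm (sin z))\<^sup>2 = (sin (Re z))\<^sup>2 + (sinh (Im z))\<^sup>2"
proof -
  have 1: "Re (sin z) = sin (Re z) * cosh (Im z)" "Im (sin z) = cos (Re z) * sinh (Im z)"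
    by (simp_all add: Re_sin Im_sin cosh_field_def sinh_field_def)
  show ?thesis
    unfolding cmod_power2 1 power_mult_distrib cosh_square_eq cos_squared_eq by (simp add: algebra_simps)
qed

lemma sinh_eq_sin: "sinh z = - \<i> * sin (\<i> * z)" for z :: complex
  by (simp add: sinh_field_def sin_exp_eq field_simps)

lemma norm_sinh_squared_eq: "(norm (sinh z))\<^sup>2 = (sinh (Re z))\<^sup>2 + (sin (Im z))\<^sup>2"
  unfolding sinh_eq_sin norm_mult norm_minus_cancel norm_ii
  using norm_sin_squared_eq[of "\<i> * z"] by simp

text \<open>The entire function with cosh x = 1 + x^2/2 + 2 x^4 \<open>cosh_tail\<close> (x^2). With
  x^2 as the variable, the same function serves sin after a change of sign of its argument.\<close>

definition cosh_tail :: "complex \<Rightarrow> complex" where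
  "cosh_tail u = (\<Sum>k. 1 / (2 * fact (2 * k + 4)) * u ^ k)"

lemma summable_cosh_tail: "summable (\<lambda>k. 1 / (2 * fact (2 * k + 4)) * (u::complex) ^ k)"
proof (rule summable_comparison_test')
  show "summable (\<lambda>k. inverse (fact k) * (norm u) ^ k)"
    by (rule summable_exp)
  fix k :: nat
  have "(fact k :: real) \<le> fact (2 * k + 4)" by (intro fact_mono) auto
  also have "\<dots> \<le> 2 * fact (2 * k + 4)" by simp
  finally show "norm (1 / (2 * fact (2 * k + 4)) * u ^ k) \<le> inverse (fact k) * (norm u) ^ k"
    by (simp add: norm_mult norm_divide norm_power divide_simps) (simp add: mult_left_mono)
qed

lemma cosh_tail_holomorphic: "cosh_tail holomorphic_on A"
proof (rule holomorphic_on_subset[of _ UNIV])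
  show "cosh_tail holomorphic_on UNIV"
    unfolding holomorphic_on_def field_differentiable_def cosh_tail_def
    using termdiffs_strong_converges_everywhere[OF summable_cosh_tail] by (auto intro: has_field_derivative_at_within)
qed simp

lemma cosh_tail_0: "cosh_tail 0 = 1 / 48"
  unfolding cosh_tail_def using powser_zero[of "\<lambda>k. 1 / (2 * fact (2 * k + 4)) :: complex"]
  by (simp add: fact_numeral)

text \<open>The half-angle formula sinh^2(x/2) = (cosh x - 1)/2 with the quadratic term, the source
  of the double pole, split off.\<close>

lemma sinh_half_squared: "(sinh (x / 2))\<^sup>2 = x\<^sup>2 / 4 + x ^ 4 * cosh_tail (x\<^sup>2)"
proof -
  have "(\<lambda>n. if even n then x ^ n /\<^sub>R fact n else 0) sums cosh x"
    by (rule cosh_converges)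
  then have "(\<lambda>k. x ^ (2 * k) /\<^sub>R fact (2 * k)) sums cosh x"
    using sums_mono_reindex[of "\<lambda>k. 2 * k" "\<lambda>n. if even n then x ^ n /\<^sub>R fact n else 0" "cosh x"]
    by (force simp: strict_mono_def elim!: evenE)
  from sums_split_initial_segment[OF this, of 2]
  have "(\<lambda>k. x ^ (2 * k + 4) /\<^sub>R fact (2 * k + 4)) sums (cosh x - (1 + x\<^sup>2 / 2))"
    by (simp add: eval_nat_numeral scaleR_conv_of_real field_simps)
  from sums_divide[OF this, of 2]
  have "(\<lambda>k. x ^ 4 * (1 / (2 * fact (2 * k + 4)) * (x\<^sup>2) ^ k)) sums ((cosh x - (1 + x\<^sup>2 / 2)) / 2)"
    by (simp add: scaleR_conv_of_real field_simps power_add flip: power_mult)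
  moreover have "(\<lambda>k. x ^ 4 * (1 / (2 * fact (2 * k + 4)) * (x\<^sup>2) ^ k)) sums (x ^ 4 * cosh_tail (x\<^sup>2))"
    unfolding cosh_tail_def by (intro sums_mult summable_sums summable_cosh_tail)
  ultimately have "(cosh x - (1 + x\<^sup>2 / 2)) / 2 = x ^ 4 * cosh_tail (x\<^sup>2)"
    by (rule sums_unique2)
  moreover have "cosh x = 1 + 2 * (sinh (x / 2))\<^sup>2"
    using cosh_double[of "x / 2"] cosh_square_eq[of "x / 2"] by simp
  ultimately show ?thesis by (simp add: field_simps)
qed

lemma sin_half_squared: "(sin (x / 2))\<^sup>2 = x\<^sup>2 / 4 - x ^ 4 * cosh_tail (- (x\<^sup>2))"
proof -
  have "(sin (x / 2))\<^sup>2 = - (sinh (\<i> * x / 2))\<^sup>2"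
    by (simp add: sinh_eq_sin power_mult_distrib)
  then show ?thesis
    unfolding sinh_half_squared by (simp add: power_mult_distrib)
qed

text \<open>Here (c, s) stands for (cos \<theta>, sin \<theta>) and e for \<Phi>^2 r^2. The
  denominators of the series are its values at w = n |\<xi>|, those of the first fraction in the
  integral its values at w = y.\<close>

definition kernel_den :: "real \<Rightarrow> real \<Rightarrow> complex \<Rightarrow> complex \<Rightarrow> complex \<Rightarrow> complex" where
  "kernel_den c s B e w = B * (sinh (of_real c * w / 2))\<^sup>2 + e * (sin (of_real s * w / 2))\<^sup>2"

text \<open>Four times the coefficient of w^2 in \<open>kernel_den\<close>; for the actual
  parameters it equals cos^2 \<theta> (B + r^2 \<phi>^2).\<close>

definition kernel_lead :: "real \<Rightarrow> real \<Rightarrow> complex \<Rightarrow> complex \<Rightarrow> complex" where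
  "kernel_lead c s B e = B * (of_real c)\<^sup>2 + e * (of_real s)\<^sup>2"

definition kernel_tail :: "real \<Rightarrow> real \<Rightarrow> complex \<Rightarrow> complex \<Rightarrow> complex \<Rightarrow> complex" where
  "kernel_tail c s B e w =
     B * of_real c ^ 4 * cosh_tail ((of_real c * w)\<^sup>2) - e * of_real s ^ 4 * cosh_tail (- ((of_real s * w)\<^sup>2))"

text \<open>The regular part \<open>1 / (8 \<pi>\<^sup>2 kernel_den w) - 1 / (2 \<pi>\<^sup>2 w\<^sup>2 kernel_lead)\<close> in a form in
  which the singularity at \<open>w = 0\<close> is removed.\<close>

definition kernel_reg :: "real \<Rightarrow> real \<Rightarrow> complex \<Rightarrow> complex \<Rightarrow> complex \<Rightarrow> complex" where
  "kernel_reg c s B e w = - kernel_tail c s B e w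
     / (2 * of_real (pi\<^sup>2) * (kernel_lead c s B e / 4 + w\<^sup>2 * kernel_tail c s B e w) * kernel_lead c s B e)"

lemma kernel_den_eq:
  "kernel_den c s B e w = w\<^sup>2 * (kernel_lead c s B e / 4 + w\<^sup>2 * kernel_tail c s B e w)"
  unfolding kernel_den_def sinh_half_squared sin_half_squared kernel_lead_def kernel_tail_def
  by (simp add: algebra_simps power_mult_distrib eval_nat_numeral)

lemma kernel_reg_eq:
  assumes "w \<noteq> 0" "kernel_den c s B e w \<noteq> 0" "kernel_lead c s B e \<noteq> 0"
  shows "kernel_reg c s B e w = 1 / (of_real (8 * pi\<^sup>2) * kernel_den c s B e w)
           - 1 / (of_real (2 * pi\<^sup>2) * w\<^sup>2 * kernel_lead c s B e)"
proof -
  define D p q where "D = kernel_lead c s B e" and "p = kernel_tail c s B e w" and "q = D / 4 + w\<^sup>2 * p"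
  have nz: "D \<noteq> 0" "q \<noteq> 0" "w \<noteq> 0" using assms by (auto simp: kernel_den_eq D_def p_def q_def)
  have "- p / (2 * P * q * D) = 1 / (8 * P * (w\<^sup>2 * q)) - 1 / (2 * P * w\<^sup>2 * D)" if "P \<noteq> 0" for P
  proof -
    \<comment> \<open>Over the common denominator the numerator is D - 4 q, in which the lead
      cancels and a factor w^2 appears.\<close>
    have "1 / (8 * P * (w\<^sup>2 * q)) - 1 / (2 * P * w\<^sup>2 * D) = (D - 4 * q) / (8 * P * w\<^sup>2 * q * D)"
      using nz that by (simp add: field_simps)
    also have "D - 4 * q = - 4 * w\<^sup>2 * p" by (simp add: q_def)
    also have "- 4 * w\<^sup>2 * p / (8 * P * w\<^sup>2 * q * D) = - p / (2 * P * q * D)"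
      using nz that by (simp add: field_simps)
    finally show ?thesis by simp
  qed
  from this[of "of_real (pi\<^sup>2)"] show ?thesis
    unfolding kernel_reg_def kernel_den_eq D_def[symmetric] p_def[symmetric] q_def[symmetric] by simp
qed

text \<open>\<open>kernel_tail\<close> at 0 carries the factor \<open>cosh_tail 0\<close> = 1/48,
  and the denominator at 0 is \<pi>^2/2 times the squared lead; hence 24.\<close>

lemma kernel_reg_0:
  "kernel_reg c s B e 0 = - (B * of_real c ^ 4 - e * of_real s ^ 4) / (of_real (24 * pi\<^sup>2) * (kernel_lead c s B e)\<^sup>2)"
  by (simp add: kernel_reg_def kernel_tail_def cosh_tail_0 power2_eq_square divide_simps)

lemma kernel_reg_even: "kernel_reg c s B e (- w) = kernel_reg c s B e w"
  by (simp add: kernel_reg_def kernel_tail_def)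

section \<open>Bounds in the strip\<close>

lemma abs_sin_ge_half:
  fixes x :: real assumes "\<bar>x\<bar> \<le> 1/2" shows "\<bar>x\<bar> / 2 \<le> \<bar>sin x\<bar>"
proof -
  have *: "y / 2 \<le> sin y" if "0 \<le> y" "y \<le> 1/2" for y :: real
  proof -
    have "\<bar>sin y - y\<bar> \<le> inverse (fact 2) * \<bar>y\<bar>\<^sup>2"
      using Maclaurin_sin_bound[of y 2] by (simp add: sin_coeff_def eval_nat_numeral)
    also have "\<dots> \<le> y / 2" using that by (simp add: power2_eq_square mult_left_le)
    finally show ?thesis by linarith
  qed
  show ?thesis using *[of "\<bar>x\<bar>"] assms by (cases "x \<ge> 0") (auto simp: abs_if)
qed

lemma abs_sinh_ge: "\<bar>x\<bar> \<le> \<bar>sinh x\<bar>" for x :: real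
proof -
  have *: "y \<le> sinh y" if "0 \<le> y" for y :: real
  proof -
    have "sinh 0 - 0 \<le> sinh y - y"
      by (rule DERIV_nonneg_imp_nondecreasing[OF that, of "\<lambda>y. sinh y - y"])
         (auto intro!: exI derivative_eq_intros simp: cosh_real_ge_1)
    then show ?thesis by simp
  qed
  show ?thesis using *[of "\<bar>x\<bar>"] by simp
qed

lemma abs_sinh_le_double:
  fixes x :: real assumes "\<bar>x\<bar> \<le> 1/2" shows "\<bar>sinh x\<bar> \<le> 2 * \<bar>x\<bar>"
proof -
  have *: "sinh y \<le> 2 * y" if "0 \<le> y" "y \<le> 1/2" for y :: real
  proof -
    have "exp y \<le> 1 + y + y\<^sup>2" using that by (intro exp_bound) auto
    moreover have "exp (- y) \<ge> 1 + - y" by (rule exp_ge_add_one_self)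
    moreover have "y\<^sup>2 \<le> y" using that by (simp add: power2_eq_square mult_left_le)
    ultimately show ?thesis using that by (simp add: sinh_field_def)
  qed
  show ?thesis using *[of "\<bar>x\<bar>"] assms by simp
qed

text \<open>With c w / 2 = u + i v, the squared modulus is sinh^2 u + sin^2 v, and |sinh u| \<ge>
  |u|, |sin v| \<ge> |v|/2 bound it below by (u^2 + v^2)/4.\<close>

lemma norm_sinh_half_ge:
  assumes "w \<in> unit_strip" "\<bar>c\<bar> \<le> 1"
  shows "c\<^sup>2 / 16 * (norm w)\<^sup>2 \<le> norm ((sinh (of_real c * w / 2))\<^sup>2)"
proof -
  define u v where "u = c * Re w / 2" and "v = c * Im w / 2"
  have "\<bar>c\<bar> * \<bar>Im w\<bar> \<le> 1 * 1" using assms by (intro mult_mono) (auto simp: unit_strip_def)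
  then have v: "\<bar>v\<bar> \<le> 1/2" by (simp add: v_def abs_mult)
  have "u\<^sup>2 \<le> (sinh u)\<^sup>2" using abs_sinh_ge by (simp add: abs_le_square_iff)
  moreover have "v\<^sup>2 / 4 \<le> (sin v)\<^sup>2"
    using abs_sin_ge_half[OF v] abs_le_square_iff[of "v / 2" "sin v"] by (simp add: power_divide)
  ultimately have "u\<^sup>2 / 4 + v\<^sup>2 / 4 \<le> (sinh u)\<^sup>2 + (sin v)\<^sup>2"
    using zero_le_power2[of u] by linarith
  also have "u\<^sup>2 / 4 + v\<^sup>2 / 4 = c\<^sup>2 / 16 * (norm w)\<^sup>2"
    by (simp add: u_def v_def cmod_power2 power_mult_distrib power_divide algebra_simps)
  also have "(sinh u)\<^sup>2 + (sin v)\<^sup>2 = norm ((sinh (of_real c * w / 2))\<^sup>2)"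
    unfolding norm_power norm_sinh_squared_eq by (simp add: u_def v_def)
  finally show ?thesis .
qed

text \<open>By the same splitting sin^2 u + sinh^2 v \<le> u^2 + 4 v^2; the growth in the imaginary
  direction is tamed by |v| \<le> 1/2.\<close>

lemma norm_sin_half_le:
  assumes "w \<in> unit_strip" "\<bar>s\<bar> \<le> 1"
  shows "norm ((sin (of_real s * w / 2))\<^sup>2) \<le> (norm w)\<^sup>2"
proof -
  define u v where "u = s * Re w / 2" and "v = s * Im w / 2"
  have "\<bar>s\<bar> * \<bar>Im w\<bar> \<le> 1 * 1" using assms by (intro mult_mono) (auto simp: unit_strip_def)
  then have v: "\<bar>v\<bar> \<le> 1/2" by (simp add: v_def abs_mult)
  have s2: "s\<^sup>2 \<le> 1" using assms(2) by (simp add: abs_square_le_1)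
  have "(sin u)\<^sup>2 \<le> u\<^sup>2" using abs_sin_x_le_abs_x by (simp add: abs_le_square_iff)
  moreover have "(sinh v)\<^sup>2 \<le> (2 * v)\<^sup>2" using abs_sinh_le_double[OF v] by (subst abs_le_square_iff[symmetric]) simp
  ultimately have "(sin u)\<^sup>2 + (sinh v)\<^sup>2 \<le> u\<^sup>2 + (2 * v)\<^sup>2" by (rule add_mono)
  also have "\<dots> \<le> s\<^sup>2 * (norm w)\<^sup>2"
    by (simp add: u_def v_def cmod_power2 power_mult_distrib power_divide algebra_simps)
  also have "\<dots> \<le> (norm w)\<^sup>2" using s2 by (simp add: mult_left_le_one_le)
  finally show ?thesis
    unfolding norm_power norm_sin_squared_eq by (simp add: u_def v_def)
qed

text \<open>The sinh term is at least a multiple of |w|^2 on the strip, so the sine term with a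
  small e cannot create a zero other than w = 0. The constants are chosen before B and e; this is
  the uniformity in \<xi>, where B tends to \<beta> = 1/T0^2 and e to 0.\<close>

lemma kernel_bounds:
  assumes c: "c \<noteq> 0" "\<bar>c\<bar> \<le> 1" and s: "\<bar>s\<bar> \<le> 1" and \<beta>: "\<beta> > 0"
  shows "\<exists>C e0. e0 > 0 \<and> (\<forall>B e. norm (B - of_real \<beta>) \<le> \<beta> / 2 \<longrightarrow> norm e \<le> e0 \<longrightarrow>
       kernel_lead c s B e \<noteq> 0 \<and>
       (\<forall>w\<in>unit_strip - {0}. kernel_den c s B e w \<noteq> 0) \<and>
       kernel_reg c s B e holomorphic_on unit_strip \<and>
       (\<forall>w\<in>unit_strip. norm (kernel_reg c s B e w) \<le> C / (1 + (Re w)\<^sup>2)))"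
proof -
  \<comment> \<open>Half of the coefficient (\<beta>/2)(c^2/16) in the lower bound for the sinh
    term; the other half absorbs the sine term, since |e| \<le> \<kappa>.\<close>
  define \<kappa> where "\<kappa> = \<beta> * c\<^sup>2 / 64"
  have \<kappa>: "\<kappa> > 0" using c \<beta> by (simp add: \<kappa>_def)
  have "bounded (cosh_tail ` cball 0 1)"
    by (intro compact_imp_bounded compact_continuous_image holomorphic_on_imp_continuous_on cosh_tail_holomorphic) auto
  then obtain R where R: "\<And>u. norm u \<le> 1 \<Longrightarrow> norm (cosh_tail u) \<le> R" and "R > 0"
    by (force simp: bounded_pos)
  \<comment> \<open>\<open>C1\<close> bounds the regular part on the unit disc as numerator over
    denominator; \<open>2 * C1\<close> accounts for 1 + (Re w)^2 \<le> 2 there, and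
    \<open>2 / \<kappa>\<close> for the region |w| > 1.\<close>
  define C1 where "C1 = (2 * \<beta> * R + \<kappa> * R) / (\<kappa> * \<kappa>)"
  define C where "C = 2 * C1 + 2 / \<kappa>"
  have C1: "C1 \<ge> 0" using \<beta> \<kappa> \<open>R > 0\<close> by (simp add: C1_def)
  show ?thesis
  proof (rule exI[of _ C], rule exI[of _ \<kappa>], intro conjI allI impI ballI)
    show "\<kappa> > 0" by (rule \<kappa>)
    fix B e :: complex
    assume B: "norm (B - of_real \<beta>) \<le> \<beta> / 2" and e: "norm e \<le> \<kappa>"
    have B1: "norm B \<ge> \<beta> / 2" "norm B \<le> 2 * \<beta>"
      using norm_triangle_ineq2[of "of_real \<beta>" B] norm_triangle_ineq2[of B "of_real \<beta>"] B \<beta>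
      by (auto simp: norm_minus_commute)
    define D where "D = kernel_lead c s B e"
    define p where "p = kernel_tail c s B e"
    define q where "q = (\<lambda>w. D / 4 + w\<^sup>2 * p w)"
    have s2: "s\<^sup>2 \<le> 1" "c\<^sup>2 \<le> 1" using c s by (auto simp: abs_square_le_1)
    have D: "norm D \<ge> 4 * \<kappa>"
    proof -
      have "\<beta> / 2 * c\<^sup>2 \<le> norm (B * (of_real c)\<^sup>2)"
        using mult_right_mono[OF B1(1), of "c\<^sup>2"] by (simp add: norm_mult norm_power)
      moreover have "norm (e * (of_real s)\<^sup>2) \<le> \<kappa> * 1"
        unfolding norm_mult using e s2 \<kappa> by (intro mult_mono) (auto simp: norm_power)
      moreover have "norm D \<ge> norm (B * (of_real c)\<^sup>2) - norm (e * (of_real s)\<^sup>2)"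
        unfolding D_def kernel_lead_def by (rule norm_diff_ineq)
      moreover have "\<beta> / 2 * c\<^sup>2 = 32 * \<kappa>" by (simp add: \<kappa>_def)
      ultimately show ?thesis using \<kappa> by linarith
    qed
    have den: "norm (kernel_den c s B e w) \<ge> \<kappa> * (norm w)\<^sup>2" if w: "w \<in> unit_strip" for w
    proof -
      have "\<beta> / 2 * (c\<^sup>2 / 16 * (norm w)\<^sup>2) \<le> norm (B * (sinh (of_real c * w / 2))\<^sup>2)"
        unfolding norm_mult using norm_sinh_half_ge[OF w c(2)] B1 \<beta> by (intro mult_mono) auto
      moreover have "norm (e * (sin (of_real s * w / 2))\<^sup>2) \<le> \<kappa> * (norm w)\<^sup>2"
        unfolding norm_mult using norm_sin_half_le[OF w s] e \<kappa> by (intro mult_mono) auto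
      moreover have "norm (kernel_den c s B e w) \<ge> norm (B * (sinh (of_real c * w / 2))\<^sup>2) - norm (e * (sin (of_real s * w / 2))\<^sup>2)"
        unfolding kernel_den_def by (rule norm_diff_ineq)
      moreover have "\<beta> / 2 * (c\<^sup>2 / 16 * (norm w)\<^sup>2) = 2 * (\<kappa> * (norm w)\<^sup>2)" by (simp add: \<kappa>_def)
      ultimately show ?thesis by linarith
    qed
    \<comment> \<open>\<open>q\<close> is \<open>kernel_den\<close> divided by w^2, so its lower
      bound comes from \<open>den\<close>; at w = 0 it is D/4, which is why |D| \<ge> 4 \<kappa> was
      proved.\<close>
    have q: "norm (q w) \<ge> \<kappa>" if w: "w \<in> unit_strip" for w
    proof (cases "w = 0")
      case True
      then show ?thesis using D by (simp add: q_def norm_divide)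
    next
      case False
      have "(norm w)\<^sup>2 * \<kappa> \<le> (norm w)\<^sup>2 * norm (q w)"
        using den[OF w] by (simp add: kernel_den_eq norm_mult norm_power q_def p_def D_def mult.commute)
      then show ?thesis using False by simp
    qed
    have D0: "D \<noteq> 0" using D \<kappa> by auto
    then show "kernel_lead c s B e \<noteq> 0" by (simp add: D_def)
    show den0: "kernel_den c s B e w \<noteq> 0" if w: "w \<in> unit_strip - {0}" for w
    proof -
      have "\<kappa> * (norm w)\<^sup>2 > 0" using w \<kappa> by simp
      then show ?thesis using den[of w] w by auto
    qed
    have q0: "q w \<noteq> 0" if "w \<in> unit_strip" for w using q[OF that] \<kappa> by auto
    have reg: "kernel_reg c s B e = (\<lambda>w. - p w / (2 * of_real (pi\<^sup>2) * q w * D))"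
      by (simp add: fun_eq_iff kernel_reg_def p_def q_def D_def)
    have p_holo: "p holomorphic_on unit_strip"
      unfolding p_def kernel_tail_def[abs_def]
      by (intro holomorphic_intros holomorphic_on_compose[OF _ cosh_tail_holomorphic, unfolded o_def])
    show "kernel_reg c s B e holomorphic_on unit_strip"
      unfolding reg using D0 q0 p_holo
      by (auto simp: q_def intro!: holomorphic_intros)
    have pi2: "pi\<^sup>2 \<ge> 1" using pi_gt3 by (simp add: one_le_power)
    show "norm (kernel_reg c s B e w) \<le> C / (1 + (Re w)\<^sup>2)" if w: "w \<in> unit_strip" for w
    \<comment> \<open>Near the removable singularity the cancelled form is used, whose numerator is
      controlled on the unit disc; farther out the two fractions are bounded separately by multiples
      of 1/|w|^2.\<close>
    proof (cases "norm w \<le> 1")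
      case True
      have "norm (p w) \<le> 2 * \<beta> * R + \<kappa> * R"
      proof -
        have 1: "norm ((of_real c * w)\<^sup>2) \<le> 1" "norm (- ((of_real s * w)\<^sup>2)) \<le> 1"
          using True c s by (auto simp: norm_power norm_mult intro!: power_le_one mult_le_one)
        have "\<bar>c\<bar> ^ 4 \<le> 1" "\<bar>s\<bar> ^ 4 \<le> 1" using c s power_le_one[of "\<bar>c\<bar>" 4] power_le_one[of "\<bar>s\<bar>" 4] by simp_all
        then have cs4: "norm ((of_real c :: complex) ^ 4) \<le> 1" "norm ((of_real s :: complex) ^ 4) \<le> 1"
          by (simp_all add: norm_power)
        have "norm (B * of_real c ^ 4 * cosh_tail ((of_real c * w)\<^sup>2)) \<le> 2 * \<beta> * 1 * R"
          unfolding norm_mult using 1 B1 cs4 \<beta> R by (intro mult_mono) auto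
        moreover have "norm (e * of_real s ^ 4 * cosh_tail (- ((of_real s * w)\<^sup>2))) \<le> \<kappa> * 1 * R"
          unfolding norm_mult using 1(2) e cs4 \<kappa> R by (intro mult_mono) auto
        ultimately show ?thesis
          unfolding p_def kernel_tail_def by (intro order_trans[OF norm_triangle_ineq4]) simp
      qed
      moreover have "\<kappa> * \<kappa> \<le> norm (2 * of_real (pi\<^sup>2) * q w * D)"
      proof -
        have "1 * \<kappa> * \<kappa> \<le> (2 * pi\<^sup>2) * norm (q w) * norm D"
          using pi2 q[OF w] D \<kappa> by (intro mult_mono) auto
        then show ?thesis by (simp add: norm_mult norm_power)
      qed
      ultimately have "norm (kernel_reg c s B e w) \<le> C1"
        unfolding reg norm_divide norm_minus_cancel C1_def using \<kappa> \<beta> \<open>R > 0\<close>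
        by (intro frac_le) auto
      also have "C1 \<le> C / (1 + (Re w)\<^sup>2)"
      proof -
        have "(Re w)\<^sup>2 \<le> 1" using True abs_Re_le_cmod[of w] by (simp add: abs_square_le_1)
        then have "C1 * (1 + (Re w)\<^sup>2) \<le> C1 * 2" using C1 by (intro mult_left_mono) auto
        also have "\<dots> \<le> C" using \<kappa> by (simp add: C_def)
        finally show ?thesis by (simp add: pos_le_divide_eq add_pos_nonneg)
      qed
      finally show ?thesis .
    next
      case False
      then have w0: "w \<noteq> 0" by auto
      have "norm (1 / (of_real (8 * pi\<^sup>2) * kernel_den c s B e w)) \<le> 1 / (2 * \<kappa> * (norm w)\<^sup>2)"
      proof -
        have "2 * (\<kappa> * (norm w)\<^sup>2) \<le> (8 * pi\<^sup>2) * norm (kernel_den c s B e w)"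
          using pi2 den[OF w] \<kappa> by (intro mult_mono) auto
        then show ?thesis using w0 \<kappa> by (simp add: norm_divide norm_mult norm_power frac_le mult.assoc)
      qed
      moreover have "norm (1 / (of_real (2 * pi\<^sup>2) * w\<^sup>2 * D)) \<le> 1 / (2 * \<kappa> * (norm w)\<^sup>2)"
      proof -
        have "2 * (norm w)\<^sup>2 * \<kappa> \<le> (2 * pi\<^sup>2) * (norm w)\<^sup>2 * norm D"
          using pi2 D \<kappa> by (intro mult_mono) auto
        then show ?thesis using w0 \<kappa> by (simp add: norm_divide norm_mult norm_power frac_le mult_ac)
      qed
      ultimately have "norm (kernel_reg c s B e w) \<le> 1 / (2 * \<kappa> * (norm w)\<^sup>2) + 1 / (2 * \<kappa> * (norm w)\<^sup>2)"
        using kernel_reg_eq[OF w0 _ D0[unfolded D_def]] den0[of w] w w0 unfolding D_def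
        by (auto intro: order_trans[OF norm_triangle_ineq4] add_mono)
      also have "\<dots> = (1 / \<kappa>) / (norm w)\<^sup>2" using w0 \<kappa> by (simp add: field_simps)
      also have "\<dots> \<le> C / (1 + (Re w)\<^sup>2)"
      proof -
        have "1 \<le> (norm w)\<^sup>2" using False by (simp add: one_le_power)
        moreover have "(Re w)\<^sup>2 \<le> (norm w)\<^sup>2" by (simp add: cmod_power2)
        ultimately have "1 + (Re w)\<^sup>2 \<le> 2 * (norm w)\<^sup>2" by linarith
        then have "(1 / \<kappa>) * (1 + (Re w)\<^sup>2) \<le> (1 / \<kappa>) * (2 * (norm w)\<^sup>2)"
          using \<kappa> by (intro mult_left_mono) auto
        also have "\<dots> \<le> C * (norm w)\<^sup>2"
        proof -
          have "2 / \<kappa> * (norm w)\<^sup>2 \<le> C * (norm w)\<^sup>2" unfolding C_def using C1 by (intro mult_right_mono) auto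
          then show ?thesis by simp
        qed
        finally have "1 / \<kappa> * (1 + (Re w)\<^sup>2) \<le> C * (norm w)\<^sup>2" .
        moreover have "a / b \<le> C / d" if "a * d \<le> C * b" "b > 0" "d > 0" for a b d :: real
          using that by (simp add: field_simps)
        ultimately have "0 < (norm w)\<^sup>2 \<Longrightarrow> 0 < 1 + (Re w)\<^sup>2 \<Longrightarrow> 1 / \<kappa> / (norm w)\<^sup>2 \<le> C / (1 + (Re w)\<^sup>2)"
          by blast
        then show ?thesis using w0 by (simp add: add_pos_nonneg)
      qed
      finally show ?thesis .
    qed
  qed
qed

section \<open>Power series in two variables\<close>

definition monomial2 :: "nat \<times> nat \<Rightarrow> complex \<Rightarrow> complex \<Rightarrow> complex" where
  "monomial2 p h k = h ^ fst p * k ^ snd p"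

definition weight2 :: "real \<Rightarrow> nat \<times> nat \<Rightarrow> real" where
  "weight2 \<rho> p = \<rho> ^ (fst p + snd p)"

text \<open>\<open>f\<close> has a power series whose coefficients have weighted \<open>l\<^sup>1\<close> norm at most \<open>N\<close>; this norm is
  submultiplicative, which makes reciprocals accessible through the geometric series.\<close>

definition l1_series :: "(complex \<Rightarrow> complex \<Rightarrow> complex) \<Rightarrow> real \<Rightarrow> real \<Rightarrow> bool" where
  "l1_series f \<rho> N \<longleftrightarrow> (\<exists>c. (\<lambda>p. norm (c p) * weight2 \<rho> p) summable_on UNIV \<and>
     (\<Sum>\<^sub>\<infinity>p. norm (c p) * weight2 \<rho> p) \<le> N \<and>
     (\<forall>h k. norm h \<le> \<rho> \<longrightarrow> norm k \<le> \<rho> \<longrightarrow> ((\<lambda>p. c p * monomial2 p h k) has_sum f h k) UNIV))"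

lemma weight2_pos: "\<rho> > 0 \<Longrightarrow> weight2 \<rho> p > 0" by (simp add: weight2_def)

lemma norm_monomial2_le:
  assumes "norm h \<le> \<rho>" "norm k \<le> \<rho>"
  shows "norm (monomial2 p h k) \<le> weight2 \<rho> p"
  unfolding monomial2_def weight2_def norm_mult norm_power power_add
  using assms by (intro mult_mono power_mono zero_le_power) (auto intro: order_trans[OF norm_ge_zero])

lemma has_sum_fibres:
  fixes f :: "'i \<Rightarrow> 'b :: {comm_monoid_add,uniform_space,uniform_topological_group_add}"
  assumes "(f has_sum s) UNIV" "\<And>p. (f has_sum g p) {i. \<mu> i = p}"
  shows "(g has_sum s) UNIV"
proof -
  have "((\<lambda>(p, i). f i) has_sum s) (SIGMA p:UNIV. {i. \<mu> i = p})"
    using assms(1) by (subst has_sum_reindex_bij_witness[of _ "\<lambda>i. (\<mu> i, i)" snd UNIV f]) auto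
  then show ?thesis
    by (rule has_sum_Sigma') (use assms(2) in auto)
qed

text \<open>Collects monomials with repeated exponents into one power series. Products (pairs of
  indices, exponents added), the geometric series (pairs of a power and an exponent) and single
  monomials are all instances.\<close>

lemma l1_series_regroup:
  fixes a :: "'i \<Rightarrow> complex" and \<mu> :: "'i \<Rightarrow> nat \<times> nat"
  assumes \<rho>: "\<rho> > 0" and summ: "((\<lambda>i. norm (a i) * weight2 \<rho> (\<mu> i)) has_sum N) UNIV"
    and f: "\<And>h k. norm h \<le> \<rho> \<Longrightarrow> norm k \<le> \<rho> \<Longrightarrow> ((\<lambda>i. a i * monomial2 (\<mu> i) h k) has_sum f h k) UNIV"
  shows "l1_series f \<rho> N"
proof -
  define c where "c = (\<lambda>p. infsum a {i. \<mu> i = p})"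
  define d where "d = (\<lambda>p. \<Sum>\<^sub>\<infinity>i\<in>{i. \<mu> i = p}. norm (a i) * weight2 \<rho> (\<mu> i))"
  have abs_a: "(\<lambda>i. norm (a i)) summable_on {i. \<mu> i = p}" for p
  proof -
    have "(\<lambda>i. norm (a i) * weight2 \<rho> (\<mu> i)) summable_on {i. \<mu> i = p}"
      by (rule summable_on_subset_banach[OF has_sum_imp_summable[OF summ]]) auto
    also have "?this \<longleftrightarrow> (\<lambda>i. norm (a i) * weight2 \<rho> p) summable_on {i. \<mu> i = p}"
      by (intro summable_on_cong) auto
    finally have "(\<lambda>i. norm (a i) * weight2 \<rho> p * (1 / weight2 \<rho> p)) summable_on {i. \<mu> i = p}"
      by (rule summable_on_cmult_left)
    then show ?thesis using weight2_pos[OF \<rho>, of p] by simp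
  qed
  have a_sum: "(a has_sum c p) {i. \<mu> i = p}" for p
    unfolding c_def by (rule has_sum_infsum[OF abs_summable_summable[OF abs_a]])
  have d_sum: "(d has_sum N) UNIV"
    unfolding d_def
    by (rule has_sum_fibres[where \<mu> = \<mu>, OF summ])
       (intro has_sum_infsum summable_on_subset_banach[OF has_sum_imp_summable[OF summ]], auto)
  \<comment> \<open>All weights on a fibre are equal, so the triangle inequality shows that
    collecting terms does not increase the norm.\<close>
  have cd: "norm (c p) * weight2 \<rho> p \<le> d p" for p
  proof -
    have "norm (c p) * weight2 \<rho> p \<le> (\<Sum>\<^sub>\<infinity>i\<in>{i. \<mu> i = p}. norm (a i)) * weight2 \<rho> p"
      unfolding c_def using weight2_pos[OF \<rho>, of p] by (intro mult_right_mono norm_infsum_bound abs_a) auto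
    also have "\<dots> = (\<Sum>\<^sub>\<infinity>i\<in>{i. \<mu> i = p}. norm (a i) * weight2 \<rho> p)"
      by (rule infsum_cmult_left[symmetric]) (use abs_a in auto)
    also have "\<dots> = d p" unfolding d_def by (intro infsum_cong) auto
    finally show ?thesis .
  qed
  have nonneg: "0 \<le> norm (c p) * weight2 \<rho> p" for p using weight2_pos[OF \<rho>, of p] by simp
  have summ_c: "(\<lambda>p. norm (c p) * weight2 \<rho> p) summable_on UNIV"
    by (rule summable_on_comparison_test[OF has_sum_imp_summable[OF d_sum]]) (use cd nonneg in auto)
  show ?thesis
    unfolding l1_series_def
  proof (intro exI[of _ c] conjI allI impI)
    show "(\<Sum>\<^sub>\<infinity>p. norm (c p) * weight2 \<rho> p) \<le> N"
      by (rule has_sum_mono[OF has_sum_infsum[OF summ_c] d_sum]) (rule cd)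
    show "((\<lambda>p. c p * monomial2 p h k) has_sum f h k) UNIV" if "norm h \<le> \<rho>" "norm k \<le> \<rho>" for h k
    proof (rule has_sum_fibres[OF f[OF that]])
      fix p
      have "((\<lambda>i. a i * monomial2 p h k) has_sum c p * monomial2 p h k) {i. \<mu> i = p}"
        by (rule has_sum_cmult_left[OF a_sum])
      also have "?this \<longleftrightarrow> ((\<lambda>i. a i * monomial2 (\<mu> i) h k) has_sum c p * monomial2 p h k) {i. \<mu> i = p}"
        by (intro has_sum_cong) auto
      finally show "((\<lambda>i. a i * monomial2 (\<mu> i) h k) has_sum c p * monomial2 p h k) {i. \<mu> i = p}" .
    qed
  qed (rule summ_c)
qed

lemma has_sum_times:
  fixes f :: "'i \<Rightarrow> complex" and g :: "'j \<Rightarrow> complex"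
  assumes f: "(f has_sum a) A" and g: "(g has_sum b) B"
  shows "((\<lambda>x. f (fst x) * g (snd x)) has_sum a * b) (A \<times> B)"
proof (rule has_sum_SigmaI[where g = "\<lambda>x. f x * b"])
  show "((\<lambda>y. f (fst (x, y)) * g (snd (x, y))) has_sum f x * b) B" for x
    using has_sum_cmult_right[OF g] by simp
  show "((\<lambda>x. f x * b) has_sum a * b) A"
    by (rule has_sum_cmult_left[OF f])
  have "(\<lambda>x. norm (f x)) summable_on A" "(\<lambda>x. norm (g x)) summable_on B"
    using f g has_sum_imp_summable by (auto simp flip: summable_on_iff_abs_summable_on_complex)
  then obtain a' b' where f': "((\<lambda>x. norm (f x)) has_sum a') A" and g': "((\<lambda>x. norm (g x)) has_sum b') B"
    by (auto simp: summable_on_def)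
  have "(\<lambda>x. norm (f (fst x) * g (snd x))) summable_on A \<times> B"
  proof (rule summable_on_SigmaI[where g = "\<lambda>x. norm (f x) * b'"])
    show "((\<lambda>y. norm (f (fst (x, y)) * g (snd (x, y)))) has_sum norm (f x) * b') B" for x
      using has_sum_cmult_right[OF g', of "norm (f x)"] by (simp add: norm_mult)
    show "(\<lambda>x. norm (f x) * b') summable_on A"
      by (rule has_sum_imp_summable[OF has_sum_cmult_left[OF f']])
  qed auto
  then show "(\<lambda>x. f (fst x) * g (snd x)) summable_on A \<times> B"
    by (rule abs_summable_summable)
qed

lemma has_sum_times_real:
  fixes f :: "'i \<Rightarrow> real" and g :: "'j \<Rightarrow> real"
  assumes f: "(f has_sum a) A" and g: "(g has_sum b) B"
  shows "((\<lambda>x. f (fst x) * g (snd x)) has_sum a * b) (A \<times> B)"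
  using has_sum_times[of "\<lambda>x. of_real (f x)" A "of_real a" "\<lambda>x. of_real (g x)" B "of_real b"] f g
  by (simp add: has_sum_of_real_iff flip: of_real_mult)

lemma l1_series_mult:
  assumes \<rho>: "\<rho> > 0" and f: "l1_series f \<rho> M" and g: "l1_series g \<rho> N" and "M \<ge> 0" "N \<ge> 0"
  shows "l1_series (\<lambda>h k. f h k * g h k) \<rho> (M * N)"
proof -
  obtain c where c: "(\<lambda>p. norm (c p) * weight2 \<rho> p) summable_on UNIV" "(\<Sum>\<^sub>\<infinity>p. norm (c p) * weight2 \<rho> p) \<le> M"
    "\<And>h k. norm h \<le> \<rho> \<Longrightarrow> norm k \<le> \<rho> \<Longrightarrow> ((\<lambda>p. c p * monomial2 p h k) has_sum f h k) UNIV"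
    using f unfolding l1_series_def by blast
  obtain d where d: "(\<lambda>p. norm (d p) * weight2 \<rho> p) summable_on UNIV" "(\<Sum>\<^sub>\<infinity>p. norm (d p) * weight2 \<rho> p) \<le> N"
    "\<And>h k. norm h \<le> \<rho> \<Longrightarrow> norm k \<le> \<rho> \<Longrightarrow> ((\<lambda>p. d p * monomial2 p h k) has_sum g h k) UNIV"
    using g unfolding l1_series_def by blast
  define M' where "M' = (\<Sum>\<^sub>\<infinity>p. norm (c p) * weight2 \<rho> p)"
  define N' where "N' = (\<Sum>\<^sub>\<infinity>p. norm (d p) * weight2 \<rho> p)"
  have N'0: "0 \<le> N'" unfolding N'_def using weight2_pos[OF \<rho>] by (intro infsum_nonneg) (simp add: less_imp_le)
  have "l1_series (\<lambda>h k. f h k * g h k) \<rho> (M' * N')"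
  proof (rule l1_series_regroup[OF \<rho>, where a = "\<lambda>x. c (fst x) * d (snd x)" and \<mu> = "\<lambda>x. fst x + snd x"])
    show "((\<lambda>x. norm (c (fst x) * d (snd x)) * weight2 \<rho> (fst x + snd x)) has_sum M' * N') UNIV"
      using has_sum_times_real[OF has_sum_infsum[OF c(1)] has_sum_infsum[OF d(1)]]
      by (simp add: M'_def N'_def weight2_def norm_mult power_add mult_ac)
    show "((\<lambda>x. c (fst x) * d (snd x) * monomial2 (fst x + snd x) h k) has_sum f h k * g h k) UNIV"
      if "norm h \<le> \<rho>" "norm k \<le> \<rho>" for h k
      using has_sum_times[OF c(3)[OF that] d(3)[OF that]]
      by (simp add: monomial2_def power_add mult_ac)
  qed
  moreover have "M' * N' \<le> M * N"
    using c(2) d(2) N'0 \<open>M \<ge> 0\<close> by (intro mult_mono) (auto simp: M'_def N'_def)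
  ultimately show ?thesis unfolding l1_series_def by (meson order_trans)
qed

lemma l1_series_add:
  assumes \<rho>: "\<rho> > 0" and f: "l1_series f \<rho> M" and g: "l1_series g \<rho> N"
  shows "l1_series (\<lambda>h k. f h k + g h k) \<rho> (M + N)"
proof -
  obtain c where c: "(\<lambda>p. norm (c p) * weight2 \<rho> p) summable_on UNIV" "(\<Sum>\<^sub>\<infinity>p. norm (c p) * weight2 \<rho> p) \<le> M"
    "\<And>h k. norm h \<le> \<rho> \<Longrightarrow> norm k \<le> \<rho> \<Longrightarrow> ((\<lambda>p. c p * monomial2 p h k) has_sum f h k) UNIV"
    using f unfolding l1_series_def by blast
  obtain d where d: "(\<lambda>p. norm (d p) * weight2 \<rho> p) summable_on UNIV" "(\<Sum>\<^sub>\<infinity>p. norm (d p) * weight2 \<rho> p) \<le> N"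
    "\<And>h k. norm h \<le> \<rho> \<Longrightarrow> norm k \<le> \<rho> \<Longrightarrow> ((\<lambda>p. d p * monomial2 p h k) has_sum g h k) UNIV"
    using g unfolding l1_series_def by blast
  have s: "(\<lambda>p. norm (c p) * weight2 \<rho> p + norm (d p) * weight2 \<rho> p) summable_on UNIV"
    by (intro summable_on_add c d)
  have le: "norm (c p + d p) * weight2 \<rho> p \<le> norm (c p) * weight2 \<rho> p + norm (d p) * weight2 \<rho> p" for p
    using weight2_pos[OF \<rho>, of p] mult_right_mono[OF norm_triangle_ineq[of "c p" "d p"], of "weight2 \<rho> p"]
    by (simp add: algebra_simps)
  have nonneg: "0 \<le> norm (c p + d p) * weight2 \<rho> p" for p using weight2_pos[OF \<rho>, of p] by simp
  have s': "(\<lambda>p. norm (c p + d p) * weight2 \<rho> p) summable_on UNIV"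
    by (rule summable_on_comparison_test[OF s]) (use le nonneg in auto)
  have "(\<Sum>\<^sub>\<infinity>p. norm (c p + d p) * weight2 \<rho> p) \<le> (\<Sum>\<^sub>\<infinity>p. norm (c p) * weight2 \<rho> p + norm (d p) * weight2 \<rho> p)"
    by (rule infsum_mono[OF s' s le])
  also have "\<dots> = (\<Sum>\<^sub>\<infinity>p. norm (c p) * weight2 \<rho> p) + (\<Sum>\<^sub>\<infinity>p. norm (d p) * weight2 \<rho> p)"
    by (rule infsum_add[OF c(1) d(1)])
  also have "\<dots> \<le> M + N" using c(2) d(2) by simp
  finally show ?thesis
    unfolding l1_series_def
    by (intro exI[of _ "\<lambda>p. c p + d p"] conjI s') (use has_sum_add[OF c(3) d(3)] in \<open>auto simp: algebra_simps\<close>)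
qed

lemma l1_series_monomial:
  assumes "\<rho> > 0"
  shows "l1_series (\<lambda>h k. v * monomial2 q h k) \<rho> (norm v * weight2 \<rho> q)"
proof (rule l1_series_regroup[OF assms, where a = "\<lambda>_::unit. v" and \<mu> = "\<lambda>_. q"])
qed (auto intro!: has_sum_finiteI)

text \<open>Without a constant term every monomial has degree at least 1 and gains a factor t when
  the radius shrinks by t. This brings the norm below 1, as the geometric series requires.\<close>

lemma l1_series_shrink:
  assumes "0 < t" "t \<le> 1" and \<rho>: "\<rho> > 0" and f: "l1_series f \<rho> N" and f0: "f 0 0 = 0"
  shows "l1_series f (t * \<rho>) (t * N)"
proof -
  obtain c where c: "(\<lambda>p. norm (c p) * weight2 \<rho> p) summable_on UNIV" "(\<Sum>\<^sub>\<infinity>p. norm (c p) * weight2 \<rho> p) \<le> N"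
    "\<And>h k. norm h \<le> \<rho> \<Longrightarrow> norm k \<le> \<rho> \<Longrightarrow> ((\<lambda>p. c p * monomial2 p h k) has_sum f h k) UNIV"
    using f unfolding l1_series_def by blast
  have "((\<lambda>p. c p * monomial2 p 0 0) has_sum c (0, 0)) UNIV"
    by (rule has_sum_finite_neutralI[of "{(0,0)}"]) (auto simp: monomial2_def)
  moreover have "((\<lambda>p. c p * monomial2 p 0 0) has_sum 0) UNIV"
    using c(3)[of 0 0] \<rho> f0 by simp
  ultimately have c0: "c (0, 0) = 0" by (rule has_sum_unique)
  have le: "norm (c p) * weight2 (t * \<rho>) p \<le> t * (norm (c p) * weight2 \<rho> p)" for p
  proof (cases "p = (0, 0)")
    case False
    then have "fst p + snd p = Suc (fst p + snd p - 1)" by (cases p) auto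
    then have "t ^ (fst p + snd p) \<le> t"
      using assms by (metis less_imp_le mult_left_le power_Suc power_le_one)
    then have "t ^ (fst p + snd p) * (norm (c p) * weight2 \<rho> p) \<le> t * (norm (c p) * weight2 \<rho> p)"
      using weight2_pos[OF \<rho>, of p] by (intro mult_right_mono) auto
    then show ?thesis by (simp add: weight2_def power_mult_distrib mult_ac)
  qed (simp add: c0)
  have nonneg: "0 \<le> norm (c p) * weight2 (t * \<rho>) p" for p
    using weight2_pos[of "t * \<rho>" p] assms by simp
  have s: "(\<lambda>p. t * (norm (c p) * weight2 \<rho> p)) summable_on UNIV"
    by (intro summable_on_cmult_right c)
  have s': "(\<lambda>p. norm (c p) * weight2 (t * \<rho>) p) summable_on UNIV"
    by (rule summable_on_comparison_test[OF s]) (use le nonneg in auto)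
  have "(\<Sum>\<^sub>\<infinity>p. norm (c p) * weight2 (t * \<rho>) p) \<le> (\<Sum>\<^sub>\<infinity>p. t * (norm (c p) * weight2 \<rho> p))"
    by (rule infsum_mono[OF s' s le])
  also have "\<dots> = t * (\<Sum>\<^sub>\<infinity>p. norm (c p) * weight2 \<rho> p)" by (rule infsum_cmult_right) (use c in auto)
  also have "\<dots> \<le> t * N" using c(2) assms by simp
  finally have "(\<Sum>\<^sub>\<infinity>p. norm (c p) * weight2 (t * \<rho>) p) \<le> t * N" .
  moreover have "((\<lambda>p. c p * monomial2 p h k) has_sum f h k) UNIV" if "norm h \<le> t * \<rho>" "norm k \<le> t * \<rho>" for h k
  proof -
    have "t * \<rho> \<le> \<rho>" using assms by (simp add: mult_left_le_one_le)
    with that show ?thesis by (intro c(3)) auto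
  qed
  ultimately show ?thesis using s' unfolding l1_series_def by blast
qed

lemma l1_series_restrict:
  assumes "0 < \<sigma>" "\<sigma> \<le> \<rho>" and f: "l1_series f \<rho> N"
  shows "l1_series f \<sigma> N"
proof -
  obtain c where c: "(\<lambda>p. norm (c p) * weight2 \<rho> p) summable_on UNIV" "(\<Sum>\<^sub>\<infinity>p. norm (c p) * weight2 \<rho> p) \<le> N"
    "\<And>h k. norm h \<le> \<rho> \<Longrightarrow> norm k \<le> \<rho> \<Longrightarrow> ((\<lambda>p. c p * monomial2 p h k) has_sum f h k) UNIV"
    using f unfolding l1_series_def by blast
  have le: "norm (c p) * weight2 \<sigma> p \<le> norm (c p) * weight2 \<rho> p" for p
    using assms by (intro mult_left_mono) (auto simp: weight2_def intro: power_mono)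
  have nonneg: "0 \<le> norm (c p) * weight2 \<sigma> p" for p
    using weight2_pos[of \<sigma> p] assms by simp
  have s': "(\<lambda>p. norm (c p) * weight2 \<sigma> p) summable_on UNIV"
    by (rule summable_on_comparison_test[OF c(1)]) (use le nonneg in auto)
  moreover have "(\<Sum>\<^sub>\<infinity>p. norm (c p) * weight2 \<sigma> p) \<le> N"
    using infsum_mono[OF s' c(1) le] c(2) by linarith
  ultimately show ?thesis using c(3) assms unfolding l1_series_def by (meson order_trans)
qed

text \<open>Neumann series: the j-th power has norm at most q^j, so the family indexed by j and the
  exponent is absolutely summable and may be collected by exponent.\<close>

lemma l1_series_geometric:
  assumes \<rho>: "\<rho> > 0" and f: "l1_series f \<rho> q" and q: "0 \<le> q" "q < 1"
  shows "\<exists>N. l1_series (\<lambda>h k. 1 / (1 - f h k)) \<rho> N"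
proof -
  have pow: "l1_series (\<lambda>h k. f h k ^ j) \<rho> (q ^ j)" for j
  proof (induction j)
    case 0
    show ?case using l1_series_monomial[OF \<rho>, of 1 "(0, 0)"] by (simp add: monomial2_def weight2_def)
  next
    case (Suc j)
    show ?case using l1_series_mult[OF \<rho> f Suc] q by simp
  qed
  then obtain c where c: "\<And>j. (\<lambda>p. norm (c j p) * weight2 \<rho> p) summable_on UNIV"
    "\<And>j. (\<Sum>\<^sub>\<infinity>p. norm (c j p) * weight2 \<rho> p) \<le> q ^ j"
    "\<And>j h k. norm h \<le> \<rho> \<Longrightarrow> norm k \<le> \<rho> \<Longrightarrow> ((\<lambda>p. c j p * monomial2 p h k) has_sum f h k ^ j) UNIV"
    unfolding l1_series_def using choice[of "\<lambda>j c. (\<lambda>p. norm (c p) * weight2 \<rho> p) summable_on UNIV \<and>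
     (\<Sum>\<^sub>\<infinity>p. norm (c p) * weight2 \<rho> p) \<le> q ^ j \<and>
     (\<forall>h k. norm h \<le> \<rho> \<longrightarrow> norm k \<le> \<rho> \<longrightarrow> ((\<lambda>p. c p * monomial2 p h k) has_sum f h k ^ j) UNIV)"]
    by blast
  have nonneg: "0 \<le> norm (c j p) * weight2 \<rho> p" for j p using weight2_pos[OF \<rho>, of p] by simp
  have geo: "(\<lambda>j. q ^ j) summable_on UNIV"
    by (rule summable_nonneg_imp_summable_on) (use q in \<open>auto intro: summable_geometric\<close>)
  have summ: "(\<lambda>x. norm (c (fst x) (snd x)) * weight2 \<rho> (snd x)) summable_on UNIV \<times> UNIV"
  proof (rule summable_on_SigmaI)
    show "((\<lambda>p. norm (c (fst (j, p)) (snd (j, p))) * weight2 \<rho> (snd (j, p))) has_sum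
        (\<Sum>\<^sub>\<infinity>p. norm (c j p) * weight2 \<rho> p)) UNIV" for j
      using has_sum_infsum[OF c(1)] by simp
    show "(\<lambda>j. \<Sum>\<^sub>\<infinity>p. norm (c j p) * weight2 \<rho> p) summable_on UNIV"
      by (rule summable_on_comparison_test[OF geo]) (use c(2) nonneg in \<open>auto intro: infsum_nonneg\<close>)
  qed (use nonneg in auto)
  have "l1_series (\<lambda>h k. 1 / (1 - f h k)) \<rho> (\<Sum>\<^sub>\<infinity>x. norm (c (fst x) (snd x)) * weight2 \<rho> (snd x))"
  proof (rule l1_series_regroup[OF \<rho>, where a = "\<lambda>x. c (fst x) (snd x)" and \<mu> = snd])
    show "((\<lambda>x. norm (c (fst x) (snd x)) * weight2 \<rho> (snd x)) has_sum
        (\<Sum>\<^sub>\<infinity>x. norm (c (fst x) (snd x)) * weight2 \<rho> (snd x))) UNIV"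
      using has_sum_infsum[OF summ] by simp
    fix h k :: complex assume hk: "norm h \<le> \<rho>" "norm k \<le> \<rho>"
    have bd: "norm (c j p * monomial2 p h k) \<le> norm (c j p) * weight2 \<rho> p" for j p
      unfolding norm_mult by (intro mult_left_mono norm_monomial2_le hk) auto
    \<comment> \<open>The coefficient norm dominates the function pointwise, so the powers of its
      values do sum to 1 / (1 - f).\<close>
    have "norm (f h k) \<le> q"
    proof -
      have 1: "(\<lambda>p. norm (c 1 p * monomial2 p h k)) summable_on UNIV"
        by (rule summable_on_comparison_test[OF c(1)[of 1]]) (use bd in auto)
      have "norm (f h k) \<le> (\<Sum>\<^sub>\<infinity>p. norm (c 1 p * monomial2 p h k))"
        using norm_has_sum_bound[OF has_sum_infsum[OF 1] c(3)[OF hk, of 1]] by simp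
      also have "\<dots> \<le> (\<Sum>\<^sub>\<infinity>p. norm (c 1 p) * weight2 \<rho> p)"
        by (rule infsum_mono[OF 1 c(1) bd])
      also have "\<dots> \<le> q" using c(2)[of 1] by simp
      finally show ?thesis .
    qed
    then have f1: "norm (f h k) < 1" using q by simp
    have "((\<lambda>x. c (fst x) (snd x) * monomial2 (snd x) h k) has_sum 1 / (1 - f h k)) (UNIV \<times> UNIV)"
    proof (rule has_sum_SigmaI[where g = "\<lambda>j. f h k ^ j"])
      show "((\<lambda>p. c (fst (j, p)) (snd (j, p)) * monomial2 (snd (j, p)) h k) has_sum f h k ^ j) UNIV" for j
        using c(3)[OF hk] by simp
      show "((\<lambda>j. f h k ^ j) has_sum 1 / (1 - f h k)) UNIV"
        using f1 by (intro norm_summable_imp_has_sum geometric_sums) (simp add: norm_power summable_geometric)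
      have "(\<lambda>x. norm (c (fst x) (snd x) * monomial2 (snd x) h k)) summable_on UNIV \<times> UNIV"
        by (rule summable_on_comparison_test[OF summ]) (use bd in auto)
      then show "(\<lambda>x. c (fst x) (snd x) * monomial2 (snd x) h k) summable_on UNIV \<times> UNIV"
        by (rule abs_summable_summable)
    qed
    then show "((\<lambda>x. c (fst x) (snd x) * monomial2 (snd x) h k) has_sum 1 / (1 - f h k)) UNIV" by simp
  qed
  then show ?thesis by blast
qed

section \<open>Analyticity at a point and its closure under arithmetic\<close>

definition analytic2_at_0 :: "(complex \<Rightarrow> complex \<Rightarrow> complex) \<Rightarrow> bool" where
  "analytic2_at_0 f \<longleftrightarrow> (\<exists>\<rho>>0. \<exists>N\<ge>0. l1_series f \<rho> N)"

lemma l1_series_mono: "l1_series f \<rho> M \<Longrightarrow> M \<le> N \<Longrightarrow> l1_series f \<rho> N"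
  unfolding l1_series_def by (meson order_trans)

lemma analytic2_at_0I: "\<rho> > 0 \<Longrightarrow> l1_series f \<rho> N \<Longrightarrow> analytic2_at_0 f"
  unfolding analytic2_at_0_def using l1_series_mono[of f \<rho> N "max 0 N"] by (meson max.cobounded1 max.cobounded2)

lemma analytic2_at_0_const: "analytic2_at_0 (\<lambda>h k. v)"
  using analytic2_at_0I[OF zero_less_one l1_series_monomial[OF zero_less_one, of v "(0, 0)"]]
  by (simp add: monomial2_def)

lemma analytic2_at_0_fst: "analytic2_at_0 (\<lambda>h k. h)"
  using analytic2_at_0I[OF zero_less_one l1_series_monomial[OF zero_less_one, of 1 "(1, 0)"]]
  by (simp add: monomial2_def)

lemma analytic2_at_0_snd: "analytic2_at_0 (\<lambda>h k. k)"
  using analytic2_at_0I[OF zero_less_one l1_series_monomial[OF zero_less_one, of 1 "(0, 1)"]]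
  by (simp add: monomial2_def)

lemma analytic2_at_0_common:
  assumes "analytic2_at_0 f" "analytic2_at_0 g"
  obtains \<rho> M N where "\<rho> > 0" "M \<ge> 0" "N \<ge> 0" "l1_series f \<rho> M" "l1_series g \<rho> N"
proof -
  from assms obtain \<rho> M \<sigma> N where *: "\<rho> > 0" "M \<ge> 0" "l1_series f \<rho> M" "\<sigma> > 0" "N \<ge> 0" "l1_series g \<sigma> N"
    unfolding analytic2_at_0_def by blast
  show thesis
    by (rule that[of "min \<rho> \<sigma>" M N])
       (use * l1_series_restrict[of "min \<rho> \<sigma>" \<rho> f M] l1_series_restrict[of "min \<rho> \<sigma>" \<sigma> g N] in auto)
qed

lemma analytic2_at_0_add:
  assumes "analytic2_at_0 f" "analytic2_at_0 g"
  shows "analytic2_at_0 (\<lambda>h k. f h k + g h k)"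
  using assms by (rule analytic2_at_0_common) (blast intro: analytic2_at_0I l1_series_add)

lemma analytic2_at_0_mult:
  assumes "analytic2_at_0 f" "analytic2_at_0 g"
  shows "analytic2_at_0 (\<lambda>h k. f h k * g h k)"
  using assms by (rule analytic2_at_0_common) (blast intro: analytic2_at_0I l1_series_mult)

lemma analytic2_at_0_inverse:
  assumes f: "analytic2_at_0 f" and f0: "f 0 0 \<noteq> 0"
  shows "analytic2_at_0 (\<lambda>h k. 1 / f h k)"
proof -
  \<comment> \<open>Then 1/f = (1 / f 0 0) / (1 - e), and \<open>e\<close> vanishes at the origin,
    so its norm can be shrunk.\<close>
  define e where "e = (\<lambda>h k. 1 + (- 1 / f 0 0) * f h k)"
  have e0: "e 0 0 = 0" using f0 by (simp add: e_def)
  have "analytic2_at_0 e"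
    unfolding e_def by (intro analytic2_at_0_add analytic2_at_0_mult analytic2_at_0_const f)
  then obtain \<rho> N where *: "\<rho> > 0" "N \<ge> 0" "l1_series e \<rho> N" unfolding analytic2_at_0_def by blast
  define t where "t = 1 / (2 * (N + 1))"
  have t: "0 < t" "t \<le> 1" "t * N \<ge> 0" "t * N < 1" using *(2) by (auto simp: t_def field_simps)
  obtain L where "l1_series (\<lambda>h k. 1 / (1 - e h k)) (t * \<rho>) L"
    using l1_series_geometric[OF _ l1_series_shrink[OF t(1,2) *(1,3) e0] t(3,4)] * t by auto
  then have "analytic2_at_0 (\<lambda>h k. 1 / (1 - e h k))"
    using * t by (intro analytic2_at_0I) auto
  from analytic2_at_0_mult[OF analytic2_at_0_const[of "1 / f 0 0"] this]
  show ?thesis using f0 by (simp add: e_def)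
qed

lemmas analytic2_at_0_intros = analytic2_at_0_const analytic2_at_0_fst analytic2_at_0_snd
  analytic2_at_0_add analytic2_at_0_mult

lemma analytic2_onI:
  assumes "\<And>a b. (a, b) \<in> S \<Longrightarrow> analytic2_at_0 (\<lambda>h k. f (a + h, b + k))"
  shows "analytic2_on f S"
  unfolding analytic2_on_def
proof
  fix p assume "p \<in> S"
  then have "analytic2_at_0 (\<lambda>h k. f (fst p + h, snd p + k))" using assms[of "fst p" "snd p"] by simp
  then obtain \<rho> N where \<rho>: "\<rho> > 0" "l1_series (\<lambda>h k. f (fst p + h, snd p + k)) \<rho> N"
    unfolding analytic2_at_0_def by blast
  from \<rho>(2) obtain c where
    c: "\<And>h k. norm h \<le> \<rho> \<Longrightarrow> norm k \<le> \<rho> \<Longrightarrow> ((\<lambda>p. c p * monomial2 p h k) has_sum f (fst p + h, snd p + k)) UNIV"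
    unfolding l1_series_def by blast
  have p_eq: "p + (h, k) = (fst p + h, snd p + k)" for h k by (simp add: prod_eq_iff)
  have "\<forall>h k. norm h < \<rho> \<longrightarrow> norm k < \<rho> \<longrightarrow>
      ((\<lambda>(m, n). c (m, n) * h ^ m * k ^ n) has_sum f (p + (h, k))) UNIV"
    unfolding p_eq using c by (simp add: monomial2_def case_prod_unfold mult.assoc)
  with \<rho>(1) show "\<exists>c. \<exists>\<rho>>0. \<forall>h k. norm h < \<rho> \<longrightarrow> norm k < \<rho> \<longrightarrow>
      ((\<lambda>(m, n). c (m, n) * h ^ m * k ^ n) has_sum f (p + (h, k))) UNIV"
    by blast
qed

subsection \<open>Restriction to complex lines and the identity theorem\<close>

definition polydisc :: "complex \<times> complex \<Rightarrow> real \<Rightarrow> (complex \<times> complex) set" where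
  "polydisc p \<rho> = ball (fst p) \<rho> \<times> ball (snd p) \<rho>"

lemma open_polydisc: "open (polydisc p \<rho>)"
  by (simp add: polydisc_def open_Times)

lemma convex_polydisc: "convex (polydisc p \<rho>)"
  by (simp add: polydisc_def convex_Times)

lemma center_in_polydisc: "\<rho> > 0 \<Longrightarrow> p \<in> polydisc p \<rho>"
  by (cases p) (simp add: polydisc_def)

definition complex_line :: "complex \<times> complex \<Rightarrow> complex \<times> complex \<Rightarrow> complex \<Rightarrow> complex \<times> complex" where
  "complex_line a v s = (fst a + s * fst v, snd a + s * snd v)"

lemma continuous_on_complex_line: "continuous_on A (complex_line a v)"
  unfolding complex_line_def by (intro continuous_intros)

lemma open_complex_line_vimage: "open S \<Longrightarrow> open (complex_line a v -` S)"
  by (rule open_vimage[OF _ continuous_on_complex_line])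

lemma convex_complex_line_vimage:
  assumes "convex S" shows "convex (complex_line a v -` S)"
proof (rule convexI)
  fix x y u w assume *: "x \<in> complex_line a v -` S" "y \<in> complex_line a v -` S" "0 \<le> (u::real)" "0 \<le> w" "u + w = 1"
  have "complex_of_real u + of_real w = 1" using *(5) by (metis of_real_1 of_real_add)
  then have w: "complex_of_real w = 1 - of_real u" by (simp add: algebra_simps)
  have "complex_line a v (u *\<^sub>R x + w *\<^sub>R y) = u *\<^sub>R complex_line a v x + w *\<^sub>R complex_line a v y"
    by (simp add: complex_line_def scaleR_conv_of_real w algebra_simps)
  also have "\<dots> \<in> S" using * convexD[OF assms] by simp
  finally show "u *\<^sub>R x + w *\<^sub>R y \<in> complex_line a v -` S" by simp
qed

text \<open>Holomorphy along every complex line is all that the identity theorem below needs, and it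
  reduces algebraic combinations to one-variable rules.\<close>

definition line_holomorphic :: "(complex \<times> complex \<Rightarrow> complex) \<Rightarrow> (complex \<times> complex) set \<Rightarrow> bool" where
  "line_holomorphic f S \<longleftrightarrow> (\<forall>a v. (\<lambda>s. f (complex_line a v s)) holomorphic_on (complex_line a v -` S))"

lemma power_series_line_holomorphic:
  assumes ser: "\<And>h k. norm h < \<rho> \<Longrightarrow> norm k < \<rho> \<Longrightarrow>
      ((\<lambda>(m, n). c (m, n) * h ^ m * k ^ n) has_sum f (p + (h, k))) UNIV"
  shows "line_holomorphic f (polydisc p \<rho>)"
  unfolding line_holomorphic_def
proof (intro allI)
  fix a v :: "complex \<times> complex"
  define W where "W = (\<lambda>r. complex_line a v -` polydisc p r)"
  have oW: "open (W r)" for r unfolding W_def by (rule open_complex_line_vimage[OF open_polydisc])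
  define h where "h = (\<lambda>s. fst (complex_line a v s) - fst p)"
  define k where "k = (\<lambda>s. snd (complex_line a v s) - snd p)"
  have W_iff: "s \<in> W r \<longleftrightarrow> norm (h s) < r \<and> norm (k s) < r" for s r
    by (cases "complex_line a v s") (auto simp: W_def polydisc_def h_def k_def dist_norm norm_minus_commute)
  have hk: "p + (h s, k s) = complex_line a v s" for s
    by (simp add: h_def k_def prod_eq_iff)
  have "\<exists>d>0. (\<lambda>s. f (complex_line a v s)) holomorphic_on ball s0 d" if s0: "s0 \<in> W \<rho>" for s0
  proof -
    \<comment> \<open>A radius strictly between the coordinate distances of s0 and \<rho>: absolute
      convergence at (r, r) supplies the majorant \<open>M\<close>.\<close>
    define r where "r = (max (norm (h s0)) (norm (k s0)) + \<rho>) / 2"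
    have r: "s0 \<in> W r" "r < \<rho>" "r > 0"
    proof -
      have "x < (max x y + \<rho>) / 2 \<and> y < (max x y + \<rho>) / 2 \<and> (max x y + \<rho>) / 2 < \<rho> \<and> (max x y + \<rho>) / 2 > 0"
        if "x < \<rho>" "y < \<rho>" "0 \<le> x" "0 \<le> y" for x y :: real
        using that by auto
      from this[of "norm (h s0)" "norm (k s0)"] show "s0 \<in> W r" "r < \<rho>" "r > 0"
        using s0 unfolding W_iff r_def by auto
    qed
    obtain d where d: "d > 0" "cball s0 d \<subseteq> W r" using oW r(1) open_contains_cball by blast
    define M where "M = (\<lambda>(m, n). norm (c (m, n)) * r ^ m * r ^ n)"
    have "(\<lambda>(m, n). c (m, n) * of_real r ^ m * of_real r ^ n) summable_on UNIV"
      using ser[of "of_real r" "of_real r"] r by (auto dest: has_sum_imp_summable)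
    then have "(\<lambda>x. norm ((\<lambda>(m, n). c (m, n) * of_real r ^ m * of_real r ^ n) x)) summable_on UNIV"
      by (simp only: summable_on_iff_abs_summable_on_complex)
    then have M: "M summable_on UNIV"
      using r by (simp add: M_def case_prod_unfold norm_mult norm_power)
    have ul: "uniform_limit (cball s0 d) (\<lambda>X s. \<Sum>x\<in>X. (\<lambda>(m, n). c (m, n) * h s ^ m * k s ^ n) x)
        (\<lambda>s. f (complex_line a v s)) (finite_subsets_at_top UNIV)"
    proof (rule Weierstrass_m_test_general'[OF _ _ M])
      fix x s assume "s \<in> cball s0 d"
      then have s: "norm (h s) < r" "norm (k s) < r" using d W_iff by auto
      show "norm ((\<lambda>(m, n). c (m, n) * h s ^ m * k s ^ n) x) \<le> M x"
        using s r by (cases x) (auto simp: M_def norm_mult norm_power intro!: mult_mono power_mono)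
    next
      fix s assume "s \<in> cball s0 d"
      then have s: "norm (h s) < r" "norm (k s) < r" using d W_iff by auto
      show "((\<lambda>x. (\<lambda>(m, n). c (m, n) * h s ^ m * k s ^ n) x) has_sum f (complex_line a v s)) UNIV"
        using ser[of "h s" "k s"] s r unfolding hk by simp
    qed
    have hol: "(\<lambda>s. \<Sum>x\<in>X. (\<lambda>(m, n). c (m, n) * h s ^ m * k s ^ n) x) holomorphic_on A" for X A
      unfolding case_prod_unfold h_def k_def complex_line_def fst_conv snd_conv by (intro holomorphic_intros)
    obtain "(\<lambda>s. f (complex_line a v s)) holomorphic_on ball s0 d"
      by (rule holomorphic_uniform_limit[OF _ ul])
         (auto intro!: always_eventually hol holomorphic_on_imp_continuous_on)
    then show ?thesis using d by blast
  qed
  then show "(\<lambda>s. f (complex_line a v s)) holomorphic_on (complex_line a v -` polydisc p \<rho>)"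
    unfolding W_def[symmetric]
    by (subst holomorphic_on_open[OF oW[unfolded W_def]])
       (metis W_def centre_in_ball field_differentiable_def holomorphic_on_imp_differentiable_at open_ball)
qed

text \<open>The complex line through x and y meets the convex set in a convex set of parameters, so
  the one-variable identity theorem carries the zero from s = 0 to s = 1.\<close>

lemma line_holomorphic_zero:
  assumes f: "line_holomorphic f S" and S: "open S" "convex S"
    and x: "x \<in> S" "\<forall>\<^sub>F q in nhds x. f q = 0" and y: "y \<in> S"
  shows "f y = 0"
proof -
  define v where "v = y - x"
  define W where "W = complex_line x v -` S"
  have ends: "complex_line x v 0 = x" "complex_line x v 1 = y"
    by (simp_all add: complex_line_def v_def)
  obtain T where T: "open T" "x \<in> T" "\<And>q. q \<in> T \<Longrightarrow> f q = 0"
    using x(2) unfolding eventually_nhds by blast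
  define V where "V = complex_line x v -` (T \<inter> S)"
  have "f (complex_line x v 1) = 0"
  proof (rule analytic_continuation_open[of V W "\<lambda>s. f (complex_line x v s)" "\<lambda>_. 0"])
    show "open V" "open W" unfolding V_def W_def using S T by (auto intro!: open_complex_line_vimage)
    show "V \<noteq> {}" using T(2) x(1) ends(1) by (auto simp: V_def)
    show "connected W" unfolding W_def by (intro convex_connected convex_complex_line_vimage S)
    show "(\<lambda>s. f (complex_line x v s)) holomorphic_on W"
      using f unfolding line_holomorphic_def W_def by blast
    show "1 \<in> W" using y ends(2) by (simp add: W_def)
  qed (auto simp: V_def W_def T(3))
  then show ?thesis by (simp only: ends)
qed

text \<open>The property that spreads is vanishing near a point, not merely at it: inside a polydisc
  it passes from any point to any other, hence throughout the connected set.\<close>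

lemma line_holomorphic_identity:
  assumes U: "open U" "connected U" and f: "\<And>p. p \<in> U \<Longrightarrow> \<exists>\<rho>>0. line_holomorphic f (polydisc p \<rho>)"
    and a: "a \<in> U" "\<forall>\<^sub>F q in nhds a. f q = 0" and b: "b \<in> U"
  shows "f b = 0"
proof -
  have "\<forall>\<^sub>F q in nhds b. f q = 0"
  proof (rule connected_induction_simple[OF U(2) a(1) b, where P = "\<lambda>p. \<forall>\<^sub>F q in nhds p. f q = 0"])
    show "\<forall>\<^sub>F q in nhds a. f q = 0" by (rule a(2))
    fix p assume p: "p \<in> U"
    obtain \<rho> where \<rho>: "\<rho> > 0" "line_holomorphic f (polydisc p \<rho>)" using f[OF p] by blast
    have "\<forall>\<^sub>F q in nhds y. f q = 0" if "x \<in> polydisc p \<rho>" "y \<in> polydisc p \<rho>" "\<forall>\<^sub>F q in nhds x. f q = 0" for x y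
      unfolding eventually_nhds
      using line_holomorphic_zero[OF \<rho>(2) open_polydisc convex_polydisc that(1,3)] open_polydisc that(2) by blast
    then show "\<exists>T. openin (top_of_set U) T \<and> p \<in> T \<and> (\<forall>x\<in>T. \<forall>y\<in>T. (\<forall>\<^sub>F q in nhds x. f q = 0) \<longrightarrow> (\<forall>\<^sub>F q in nhds y. f q = 0))"
      using center_in_polydisc[OF \<rho>(1), of p] p
      by (intro exI[of _ "U \<inter> polydisc p \<rho>"]) (auto intro: openin_open_Int open_polydisc)
  qed
  then show ?thesis by (rule eventually_nhds_x_imp_x)
qed

lemma holomorphic_zero_on_ball_of_real:
  assumes "g holomorphic_on ball 0 \<rho>" "\<delta> > 0" "\<delta> \<le> \<rho>"
    and "\<And>x. \<bar>x\<bar> < \<delta> \<Longrightarrow> g (of_real x) = 0" and w: "w \<in> ball 0 \<rho>"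
  shows "g w = 0"
proof (rule analytic_continuation[of g "ball 0 \<rho>" "of_real ` {-\<delta><..<\<delta>}" 0 w])
  show "0 islimpt complex_of_real ` {-\<delta><..<\<delta>}"
    unfolding islimpt_approachable
  proof (intro allI impI)
    fix e :: real assume "e > 0"
    then show "\<exists>x'\<in>complex_of_real ` {-\<delta><..<\<delta>}. x' \<noteq> 0 \<and> dist x' 0 < e"
      using \<open>\<delta> > 0\<close> by (intro bexI[of _ "of_real (min (\<delta>/2) (e/2))"] imageI) auto
  qed
qed (use assms in auto)

text \<open>Vanishing on the real plane propagates first to one complex variable, then to the other.\<close>

lemma line_holomorphic_real_zero:
  assumes f: "line_holomorphic f (polydisc (0, 0) \<rho>)" and \<delta>: "0 < \<delta>" "\<delta> \<le> \<rho>"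
    and real: "\<And>x y. \<bar>x\<bar> < \<delta> \<Longrightarrow> \<bar>y\<bar> < \<delta> \<Longrightarrow> f (of_real x, of_real y) = 0"
  shows "\<forall>\<^sub>F q in nhds (0, 0). f q = 0"
proof -
  have *: "f (of_real x, w) = 0" if "\<bar>x\<bar> < \<delta>" "w \<in> ball 0 \<rho>" for x w
  proof (rule holomorphic_zero_on_ball_of_real[OF _ \<delta> _ that(2)])
    have "(\<lambda>s. f (complex_line (of_real x, 0) (0, 1) s)) holomorphic_on complex_line (of_real x, 0) (0, 1) -` polydisc (0, 0) \<rho>"
      using f by (simp add: line_holomorphic_def)
    then have "(\<lambda>s. f (of_real x, s)) holomorphic_on complex_line (of_real x, 0) (0, 1) -` polydisc (0, 0) \<rho>"
      by (simp add: complex_line_def)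
    then show "(\<lambda>s. f (of_real x, s)) holomorphic_on ball 0 \<rho>"
      by (rule holomorphic_on_subset) (use that \<delta> in \<open>auto simp: complex_line_def polydisc_def\<close>)
  qed (use real that in auto)
  have "f (z, w) = 0" if "z \<in> ball 0 \<rho>" "w \<in> ball 0 \<rho>" for z w
  proof (rule holomorphic_zero_on_ball_of_real[OF _ \<delta> _ that(1)])
    have "(\<lambda>s. f (complex_line (0, w) (1, 0) s)) holomorphic_on complex_line (0, w) (1, 0) -` polydisc (0, 0) \<rho>"
      using f by (simp add: line_holomorphic_def)
    then have "(\<lambda>s. f (s, w)) holomorphic_on complex_line (0, w) (1, 0) -` polydisc (0, 0) \<rho>"
      by (simp add: complex_line_def)
    then show "(\<lambda>s. f (s, w)) holomorphic_on ball 0 \<rho>"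
      by (rule holomorphic_on_subset) (use that \<delta> in \<open>auto simp: complex_line_def polydisc_def\<close>)
  qed (use * that in auto)
  then have "f q = 0" if "q \<in> polydisc (0, 0) \<rho>" for q
    using that by (cases q) (auto simp: polydisc_def)
  moreover have "(0, 0) \<in> polydisc (0, 0) \<rho>" using \<delta> by (intro center_in_polydisc) simp
  ultimately show ?thesis
    unfolding eventually_nhds using open_polydisc by blast
qed

section \<open>Four-temperature and vorticity\<close>

lemma four_eq_zero_index: "(4::4) = 0"
  by simp

lemma sum_index_4: "sum f (UNIV :: 4 set) = f 0 + f 1 + f 2 + f 3"
  unfolding sum_4 four_eq_zero_index by (simp add: add_ac)

lemma all_index_4: "(\<forall>i::4. P i) \<longleftrightarrow> P 0 \<and> P 1 \<and> P 2 \<and> P 3"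
  unfolding forall_4 four_eq_zero_index by auto

lemma vec4_nth: "vec4 v0 v1 v2 v3 $ 0 = v0" "vec4 v0 v1 v2 v3 $ 1 = v1" "vec4 v0 v1 v2 v3 $ 2 = v2" "vec4 v0 v1 v2 v3 $ 3 = v3"
  by (simp_all add: vec4_def)

lemma lower_nth: "lower v $ 0 = v $ 0" "lower v $ 1 = - (v $ 1)" "lower v $ 2 = - (v $ 2)" "lower v $ 3 = - (v $ 3)"
  by (simp_all add: lower_def minkowski_def matrix_vector_mult_def sum_index_4)

lemma lorentz_sq_eq: "lorentz_sq v = (v $ 0)\<^sup>2 - (v $ 1)\<^sup>2 - (v $ 2)\<^sup>2 - (v $ 3)\<^sup>2"
  by (simp add: lorentz_sq_def inner_vec_def sum_index_4 lower_nth power2_eq_square)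

lemma lorentz_sq_scaleR: "lorentz_sq (k *\<^sub>R v) = k\<^sup>2 * lorentz_sq v"
  by (simp add: lorentz_sq_eq power_mult_distrib algebra_simps)

text \<open>The matrix of \<varpi> with both indices down, read off from the affine form b +
  \<varpi> x of the lowered four-temperature.\<close>

definition vorticity_mat :: "real \<Rightarrow> real \<Rightarrow> real \<Rightarrow> real ^ 4 ^ 4" where
  "vorticity_mat T0 a \<omega> = (\<chi> i j.
     if i = 0 \<and> j = 3 then a / T0 else if i = 3 \<and> j = 0 then - (a / T0)
     else if i = 1 \<and> j = 2 then \<omega> / T0 else if i = 2 \<and> j = 1 then - (\<omega> / T0) else 0)"

lemma lower_four_temp:
  "lower (four_temp T0 a \<omega> X) = vec4 (1 / T0) 0 0 0 + vorticity_mat T0 a \<omega> *v X"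
  by (simp add: vec_eq_iff all_index_4 lower_nth four_temp_def vec4_nth vorticity_mat_def
      matrix_vector_mult_def sum_index_4 add_divide_distrib)

lemma thermal_vorticity_eq: "thermal_vorticity T0 a \<omega> = vorticity_mat T0 a \<omega>"
  unfolding thermal_vorticity_def
proof (rule the_equality)
  show "\<exists>b. \<forall>X. lower (four_temp T0 a \<omega> X) = b + vorticity_mat T0 a \<omega> *v X"
    using lower_four_temp by blast
next
  fix W assume "\<exists>b. \<forall>X. lower (four_temp T0 a \<omega> X) = b + W *v X"
  then obtain b where b: "\<And>X. vec4 (1 / T0) 0 0 0 + vorticity_mat T0 a \<omega> *v X = b + W *v X"
    unfolding lower_four_temp by blast
  \<comment> \<open>The point X = 0 fixes b; equality on all vectors then fixes the matrix.\<close>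
  have "b = vec4 (1 / T0) 0 0 0" using b[of 0] by simp
  then have "\<And>X. W *v X = vorticity_mat T0 a \<omega> *v X" using b by simp
  then show "W = vorticity_mat T0 a \<omega>" by (simp add: matrix_eq)
qed

lemma four_temp_lorentz_sq:
  "lorentz_sq (four_temp T0 a \<omega> (vec4 t x y z)) = ((1 + a * z)\<^sup>2 - a\<^sup>2 * t\<^sup>2 - (x\<^sup>2 + y\<^sup>2) * \<omega>\<^sup>2) / T0\<^sup>2"
proof -
  have "lorentz_sq (vec4 (1 + a * z) (- \<omega> * y) (\<omega> * x) (a * t)) = (1 + a * z)\<^sup>2 - a\<^sup>2 * t\<^sup>2 - (x\<^sup>2 + y\<^sup>2) * \<omega>\<^sup>2"
    by (simp add: lorentz_sq_eq vec4_nth power_mult_distrib algebra_simps)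
  then show ?thesis
    unfolding four_temp_def lorentz_sq_scaleR vec4_nth by (simp add: power_divide)
qed

text \<open>Raising both indices flips the sign of the time-space entries only.\<close>

lemma raise_vorticity_mult:
  "raise_both (vorticity_mat T0 a \<omega>) *v v =
     vec4 (- (a / T0) * v $ 3) (\<omega> / T0 * v $ 2) (- (\<omega> / T0) * v $ 1) (a / T0 * v $ 0)"
  by (simp add: vec_eq_iff all_index_4 vec4_nth raise_both_def minkowski_def vorticity_mat_def
      matrix_vector_mult_def matrix_matrix_mult_def sum_index_4)

lemma alpha_vec_lorentz_sq:
  fixes T0 a \<omega> t x y z :: real
  defines "\<beta>2 \<equiv> lorentz_sq (four_temp T0 a \<omega> (vec4 t x y z))"
  assumes "\<beta>2 > 0"
  shows "lorentz_sq (alpha_vec T0 a \<omega> (vec4 t x y z)) =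
     - (a\<^sup>2 * ((1 + a * z)\<^sup>2 - a\<^sup>2 * t\<^sup>2) + (x\<^sup>2 + y\<^sup>2) * \<omega> ^ 4) / (\<beta>2 * T0 ^ 4)"
proof -
  have "alpha_vec T0 a \<omega> (vec4 t x y z) =
     (1 / sqrt \<beta>2 / T0\<^sup>2) *\<^sub>R vec4 (a\<^sup>2 * t) (- \<omega>\<^sup>2 * x) (- \<omega>\<^sup>2 * y) (a * (1 + a * z))"
    unfolding alpha_vec_def thermal_vorticity_eq raise_vorticity_mult four_velocity_def \<beta>2_def[symmetric]
    by (simp add: vec_eq_iff all_index_4 vec4_nth lower_nth four_temp_def power2_eq_square mult_ac)
  moreover have "(1 / sqrt \<beta>2 / T0\<^sup>2)\<^sup>2 = 1 / (\<beta>2 * T0 ^ 4)"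
    using assms by (simp add: power_divide power_mult_distrib flip: power_mult)
  moreover have "lorentz_sq (vec4 (a\<^sup>2 * t) (- \<omega>\<^sup>2 * x) (- \<omega>\<^sup>2 * y) (a * (1 + a * z))) =
      - (a\<^sup>2 * ((1 + a * z)\<^sup>2 - a\<^sup>2 * t\<^sup>2) + (x\<^sup>2 + y\<^sup>2) * \<omega> ^ 4)"
    unfolding lorentz_sq_eq vec4_nth power_mult_distrib by (simp add: algebra_simps flip: power_mult)
  ultimately show ?thesis by (simp add: lorentz_sq_scaleR)
qed

section \<open>The function A and its continuation\<close>

definition A_den :: "real \<Rightarrow> real \<Rightarrow> real \<Rightarrow> real \<Rightarrow> complex \<times> complex \<Rightarrow> complex" where
  "A_den T0 r t z q = B_fun T0 t z (fst q) + (of_real r)\<^sup>2 * (snd q)\<^sup>2"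

definition A_dom :: "real \<Rightarrow> real \<Rightarrow> real \<Rightarrow> real \<Rightarrow> (complex \<times> complex) set" where
  "A_dom T0 r t z = {q. A_den T0 r t z q \<noteq> 0}"

text \<open>The constant coefficient 1/T0^2 is nonzero for \<open>T0 \<noteq> 0\<close>, so a
  complex line through the origin carries only finitely many zeros, even if the higher coefficients
  vanish.\<close>

lemma A_den_line_poly:
  "A_den T0 r t z (complex_line (0, 0) p s) =
     poly [:(1 / of_real T0)\<^sup>2, - 2 * \<i> * fst p * of_real z / of_real T0,
       (of_real t)\<^sup>2 * (fst p)\<^sup>2 - (fst p)\<^sup>2 * (of_real z)\<^sup>2 + (of_real r)\<^sup>2 * (snd p)\<^sup>2:] s"
  by (simp add: A_den_def B_fun_def complex_line_def power2_eq_square algebra_simps)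

lemma open_A_dom: "open (A_dom T0 r t z)"
  unfolding A_dom_def A_den_def B_fun_def
  by (intro open_Collect_neq continuous_intros)

lemma zero_in_A_dom: "T0 \<noteq> 0 \<Longrightarrow> (0, 0) \<in> A_dom T0 r t z"
  by (simp add: A_dom_def A_den_def B_fun_def)

text \<open>The real segment from the origin to a point may meet the zero set, but on the complex line
  through them the zero set is finite.\<close>

lemma connected_A_dom:
  assumes "T0 \<noteq> 0"
  shows "connected (A_dom T0 r t z)"
proof -
  \<comment> \<open>The part of a complex line outside the zero set is the image of a plane minus
    finitely many points, hence connected; all these parts share the origin.\<close>
  define L where "L = (\<lambda>p. complex_line (0, 0) p ` {s. A_den T0 r t z (complex_line (0, 0) p s) \<noteq> 0})"
  have "connected (L p)" for p
  proof -
    have "finite {s. A_den T0 r t z (complex_line (0, 0) p s) = 0}"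
      unfolding A_den_line_poly by (rule poly_roots_finite) (use assms in simp)
    then have "connected (UNIV - {s. A_den T0 r t z (complex_line (0, 0) p s) = 0})"
      by (intro connected_open_delete_finite) auto
    also have "UNIV - {s. A_den T0 r t z (complex_line (0, 0) p s) = 0} = {s. A_den T0 r t z (complex_line (0, 0) p s) \<noteq> 0}"
      by auto
    finally show ?thesis
      unfolding L_def by (intro connected_continuous_image continuous_on_complex_line)
  qed
  moreover have "(0, 0) \<in> L p" for p
    unfolding L_def using zero_in_A_dom[OF assms, of r t z]
    by (intro image_eqI[of _ _ 0]) (auto simp: complex_line_def A_dom_def)
  then have "(\<Inter>p\<in>A_dom T0 r t z. L p) \<noteq> {}" by blast
  ultimately have "connected (\<Union>p\<in>A_dom T0 r t z. L p)"
    by (intro connected_Union) auto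
  also have "(\<Union>p\<in>A_dom T0 r t z. L p) = A_dom T0 r t z"
  proof
    show "A_dom T0 r t z \<subseteq> (\<Union>p\<in>A_dom T0 r t z. L p)"
    proof
      fix p assume p: "p \<in> A_dom T0 r t z"
      moreover have "p \<in> L p"
        unfolding L_def using p by (intro image_eqI[of _ _ 1]) (auto simp: complex_line_def A_dom_def)
      ultimately show "p \<in> (\<Union>p\<in>A_dom T0 r t z. L p)" by blast
    qed
  qed (auto simp: L_def A_dom_def)
  finally show ?thesis .
qed

lemma A_fun_analytic: "analytic2_on (\<lambda>(\<Phi>, \<phi>). A_fun T0 r t z \<Phi> \<phi>) (A_dom T0 r t z)"
proof (rule analytic2_onI)
  fix a b :: complex assume ab: "(a, b) \<in> A_dom T0 r t z"
  \<comment> \<open>Squares are written as products and differences as sums with a factor -1, to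
    match the forms in \<open>analytic2_at_0_intros\<close>.\<close>
  define Bf where "Bf = (\<lambda>h k :: complex. (of_real t)\<^sup>2 * ((a + h) * (a + h))
      + (1 / of_real T0 + (- 1) * (\<i> * (a + h) * of_real z)) * (1 / of_real T0 + (- 1) * (\<i> * (a + h) * of_real z)))"
  define D where "D = (\<lambda>h k. Bf h k + (of_real r)\<^sup>2 * ((b + k) * (b + k)))"
  have Bf: "analytic2_at_0 Bf" unfolding Bf_def by (intro analytic2_at_0_intros)
  have D: "analytic2_at_0 D" unfolding D_def by (intro analytic2_at_0_intros Bf)
  have Bf_eq: "B_fun T0 t z (a + h) = Bf h k" for h k
    by (simp add: B_fun_def Bf_def power2_eq_square)
  have D_eq: "A_den T0 r t z (a + h, b + k) = D h k" for h k
    unfolding A_den_def fst_conv snd_conv Bf_eq[of h k] D_def by (simp add: power2_eq_square)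
  have "D 0 0 \<noteq> 0" using ab D_eq[of 0 0] by (simp add: A_dom_def)
  then have inv: "analytic2_at_0 (\<lambda>h k. 1 / D h k)" by (rule analytic2_at_0_inverse[OF D])
  have "(case (a + h, b + k) of (\<Phi>, \<phi>) \<Rightarrow> A_fun T0 r t z \<Phi> \<phi>) =
      (1 / 12) * (1 / D h k) + (- 1 / (48 * (of_real pi)\<^sup>2)) *
      (((of_real r)\<^sup>2 * ((b + k) * ((b + k) * ((b + k) * (b + k)))) + (- 1) * (Bf h k * ((a + h) * (a + h))))
        * ((1 / D h k) * (1 / D h k)))" for h k
  proof -
    have 4: "x ^ 4 = x * (x * (x * x))" for x :: complex by (simp add: eval_nat_numeral)
    show ?thesis
      using D_eq[of h k] unfolding A_fun_def A_den_def fst_conv snd_conv prod.case Bf_eq[of h k]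
      by (simp add: 4) (simp add: power2_eq_square)
  qed
  then show "analytic2_at_0 (\<lambda>h k. case (a + h, b + k) of (\<Phi>, \<phi>) \<Rightarrow> A_fun T0 r t z \<Phi> \<phi>)"
    by (simp only:) (intro analytic2_at_0_intros inv Bf)
qed

lemma continuation_value_A_fun:
  assumes "T0 \<noteq> 0" "p \<in> A_dom T0 r t z"
  shows "continuation_value (A_real T0 r t z) p (A_fun T0 r t z (fst p) (snd p))"
  unfolding continuation_value_def
proof (intro exI conjI)
  show "open (A_dom T0 r t z)" by (rule open_A_dom)
  show "connected (A_dom T0 r t z)" by (rule connected_A_dom[OF assms(1)])
  show "(0, 0) \<in> A_dom T0 r t z" by (rule zero_in_A_dom[OF assms(1)])
  show "analytic2_on (\<lambda>(\<Phi>, \<phi>). A_fun T0 r t z \<Phi> \<phi>) (A_dom T0 r t z)" by (rule A_fun_analytic)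
  show "(0::real) < 1" by simp
qed (use assms(2) in \<open>auto simp: case_prod_unfold\<close>)

text \<open>Clearing denominators turns the uniqueness of the continuation into the vanishing of a
  function that is analytic on all of the given domain, which need not lie in \<open>A_dom\<close>.\<close>

lemma continuation_value_unique:
  assumes "T0 \<noteq> 0" and p: "p \<in> A_dom T0 r t z" and v: "continuation_value (A_real T0 r t z) p v"
  shows "v = A_fun T0 r t z (fst p) (snd p)"
proof -
  obtain U g \<delta> where U: "open U" "connected U" "(0, 0) \<in> U" "p \<in> U" and g: "analytic2_on g U"
    and \<delta>: "\<delta> > 0" "\<And>x y. \<bar>x\<bar> < \<delta> \<Longrightarrow> \<bar>y\<bar> < \<delta> \<Longrightarrow> g (of_real x, of_real y) = A_real T0 r t z x y"
    and v: "g p = v"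
    using v unfolding continuation_value_def by blast
  define D where "D = A_den T0 r t z"
  \<comment> \<open>This is 48 \<pi>^2 D^2 (g - A) wherever D \<noteq> 0. Being polynomial in g and
    the coordinates, it is also analytic at zeros of D inside U.\<close>
  define G where "G = (\<lambda>q. 48 * (of_real pi)\<^sup>2 * (D q)\<^sup>2 * g q
     - (4 * (of_real pi)\<^sup>2 * D q - ((of_real r)\<^sup>2 * snd q ^ 4 - B_fun T0 t z (fst q) * (fst q)\<^sup>2)))"
  have G_A: "G q = 0" if "D q \<noteq> 0" "g q = A_fun T0 r t z (fst q) (snd q)" for q
  proof -
    have *: "48 * P * d\<^sup>2 * (1 / (12 * d) - n / (48 * P * d\<^sup>2)) - (4 * P * d - n) = 0"
      if "P \<noteq> 0" "d \<noteq> 0" for P d n :: complex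
      using that by (simp add: right_diff_distrib) (simp add: power2_eq_square)
    show ?thesis
      unfolding G_def that(2) A_fun_def
      using *[of "(of_real pi)\<^sup>2" "D q"] that(1) by (simp add: D_def A_den_def)
  qed
  have G_line: "\<exists>\<rho>>0. line_holomorphic G (polydisc q \<rho>)" if q: "q \<in> U" for q
  proof -
    obtain c \<rho> where \<rho>: "\<rho> > 0" and "\<And>h k. norm h < \<rho> \<Longrightarrow> norm k < \<rho> \<Longrightarrow>
        ((\<lambda>(m, n). c (m, n) * h ^ m * k ^ n) has_sum g (q + (h, k))) UNIV"
      using g q unfolding analytic2_on_def by blast
    then have gl: "line_holomorphic g (polydisc q \<rho>)" by (intro power_series_line_holomorphic)
    have "line_holomorphic G (polydisc q \<rho>)"
      unfolding line_holomorphic_def G_def D_def A_den_def B_fun_def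
    proof (intro allI)
      fix a v
      have "(\<lambda>s. g (complex_line a v s)) holomorphic_on (complex_line a v -` polydisc q \<rho>)"
        using gl unfolding line_holomorphic_def by blast
      moreover have "(\<lambda>s. fst (complex_line a v s)) holomorphic_on S" "(\<lambda>s. snd (complex_line a v s)) holomorphic_on S" for S
        unfolding complex_line_def fst_conv snd_conv by (intro holomorphic_intros)+
      ultimately show "(\<lambda>s. 48 * (of_real pi)\<^sup>2 * ((of_real t)\<^sup>2 * (fst (complex_line a v s))\<^sup>2
            + (1 / of_real T0 - \<i> * fst (complex_line a v s) * of_real z)\<^sup>2 + (of_real r)\<^sup>2 * (snd (complex_line a v s))\<^sup>2)\<^sup>2
            * g (complex_line a v s)
          - (4 * (of_real pi)\<^sup>2 * ((of_real t)\<^sup>2 * (fst (complex_line a v s))\<^sup>2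
            + (1 / of_real T0 - \<i> * fst (complex_line a v s) * of_real z)\<^sup>2 + (of_real r)\<^sup>2 * (snd (complex_line a v s))\<^sup>2)
            - ((of_real r)\<^sup>2 * snd (complex_line a v s) ^ 4 - ((of_real t)\<^sup>2 * (fst (complex_line a v s))\<^sup>2
            + (1 / of_real T0 - \<i> * fst (complex_line a v s) * of_real z)\<^sup>2) * (fst (complex_line a v s))\<^sup>2)))
          holomorphic_on complex_line a v -` polydisc q \<rho>"
        by (intro holomorphic_intros)
    qed
    then show ?thesis using \<rho> by blast
  qed
  have G0: "\<forall>\<^sub>F q in nhds (0, 0). G q = 0"
  proof -
    obtain \<rho> where \<rho>: "\<rho> > 0" "line_holomorphic G (polydisc (0, 0) \<rho>)" using G_line[OF U(3)] by blast
    obtain d where d: "d > 0" "ball (0, 0) d \<subseteq> A_dom T0 r t z"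
      using open_A_dom zero_in_A_dom[OF assms(1)] open_contains_ball by blast
    show ?thesis
    \<comment> \<open>Half of d suffices because the norm of the pair is estimated by |x| +
      |y|.\<close>
    proof (rule line_holomorphic_real_zero[OF \<rho>(2), of "min \<rho> (min \<delta> (d / 2))"])
      fix x y :: real
      assume xy: "\<bar>x\<bar> < min \<rho> (min \<delta> (d / 2))" "\<bar>y\<bar> < min \<rho> (min \<delta> (d / 2))"
      have "norm (complex_of_real x, complex_of_real y) \<le> \<bar>x\<bar> + \<bar>y\<bar>"
        using norm_Pair_le[of "complex_of_real x" "complex_of_real y"] by simp
      also have "\<dots> < d" using xy by auto
      finally have "(complex_of_real x, complex_of_real y) \<in> ball (0, 0) d"
        by (simp add: dist_norm) (simp add: norm_Pair)
      then have "D (of_real x, of_real y) \<noteq> 0" using d by (auto simp: A_dom_def D_def)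
      then show "G (of_real x, of_real y) = 0" using \<delta>(2)[of x y] xy by (intro G_A) auto
    qed (use \<rho> \<delta> d in auto)
  qed
  have "G p = 0" by (rule line_holomorphic_identity[OF U(1,2) G_line U(3) G0 U(4)])
  then have eq: "48 * (of_real pi)\<^sup>2 * (D p)\<^sup>2 * v =
      4 * (of_real pi)\<^sup>2 * D p - ((of_real r)\<^sup>2 * snd p ^ 4 - B_fun T0 t z (fst p) * (fst p)\<^sup>2)"
    by (simp add: G_def v)
  have D0: "D p \<noteq> 0" using p by (simp add: A_dom_def D_def)
  have *: "v = 1 / (12 * d) - n / (48 * P * d\<^sup>2)" if "48 * P * d\<^sup>2 * v = 4 * P * d - n" "P \<noteq> 0" "d \<noteq> 0" for P d n :: complex
  proof -
    have "v = (4 * P * d - n) / (48 * P * d\<^sup>2)" using that by (simp add: field_simps)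
    also have "\<dots> = 1 / (12 * d) - n / (48 * P * d\<^sup>2)"
      using that by (simp add: diff_divide_distrib power2_eq_square)
    finally show ?thesis .
  qed
  show ?thesis
    unfolding A_fun_def using *[OF eq _ D0] by (simp add: D_def A_den_def)
qed

section \<open>The asymptotic expansion\<close>

lemma of_real_sinh_complex: "complex_of_real (sinh x) = sinh (of_real x)"
  by (simp add: sinh_field_def flip: exp_of_real)

text \<open>The squares of sinh and sin are even, so \<xi> may be replaced by |\<xi>| and the mesh
  is positive on both sides of 0.\<close>

lemma Psi_denom_eq_kernel:
  "Psi_denom T0 r t z (\<xi> * c) (\<xi> * s) n =
     kernel_den c s (B_fun T0 t z (of_real (\<xi> * c))) (of_real ((\<xi> * c)\<^sup>2 * r\<^sup>2)) (of_real (real n * \<bar>\<xi>\<bar>))"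
proof -
  have "(sinh (real n * (\<xi> * c) / 2))\<^sup>2 = (sinh (c * (real n * \<bar>\<xi>\<bar>) / 2))\<^sup>2"
    by (cases "\<xi> \<ge> 0") (simp_all add: mult_ac)
  moreover have "(sin (real n * (\<xi> * s) / 2))\<^sup>2 = (sin (s * (real n * \<bar>\<xi>\<bar>) / 2))\<^sup>2"
    by (cases "\<xi> \<ge> 0") (simp_all add: mult_ac)
  ultimately show ?thesis
    unfolding Psi_denom_def kernel_den_def
    by (simp add: mult_ac of_real_sinh_complex flip: sin_of_real)
qed

lemma I_denom1_eq_kernel:
  "I_denom1 T0 r t z \<theta> \<xi> y =
     kernel_den (cos \<theta>) (sin \<theta>) (B_fun T0 t z (of_real (\<xi> * cos \<theta>))) (of_real ((\<xi> * cos \<theta>)\<^sup>2 * r\<^sup>2)) (of_real y)"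
  by (simp add: I_denom1_def kernel_den_def mult_ac of_real_sinh_complex flip: sin_of_real)

lemma I_denom2_eq_kernel:
  "I_denom2 T0 r t z \<theta> \<xi> =
     kernel_lead (cos \<theta>) (sin \<theta>) (B_fun T0 t z (of_real (\<xi> * cos \<theta>))) (of_real ((\<xi> * cos \<theta>)\<^sup>2 * r\<^sup>2))"
  by (simp add: I_denom2_def kernel_lead_def)

text \<open>\<open>A\<close> collects the contribution of the double pole at \<open>y = 0\<close>, through \<open>\<zeta>(2) = \<pi>\<^sup>2/6\<close>, and the
  endpoint term of the trapezoidal sum.\<close>

lemma A_real_eq_kernel:
  fixes T0 r t z c s \<xi> :: real
  defines "B \<equiv> B_fun T0 t z (of_real (\<xi> * c))" and "e \<equiv> complex_of_real ((\<xi> * c)\<^sup>2 * r\<^sup>2)"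
  assumes c: "c \<noteq> 0" and L: "kernel_lead c s B e \<noteq> 0"
  shows "A_real T0 r t z (\<xi> * c) (\<xi> * s) =
     (of_real c)\<^sup>2 / (12 * kernel_lead c s B e) - (of_real (\<xi> * c))\<^sup>2 * kernel_reg c s B e 0 / 2"
proof -
  \<comment> \<open>\<open>E\<close> is the denominator B + r^2 \<phi>^2 of A; the lead is c^2 E,
    and the powers of c cancel in both terms.\<close>
  define E where "E = B + (of_real r)\<^sup>2 * (of_real (\<xi> * s))\<^sup>2"
  have lead: "kernel_lead c s B e = (of_real c)\<^sup>2 * E"
    by (simp add: kernel_lead_def E_def e_def algebra_simps power_mult_distrib)
  have nz: "complex_of_real c \<noteq> 0" "E \<noteq> 0" "(complex_of_real pi) \<noteq> 0" using L c by (auto simp: lead)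
  have "X * (- n / (of_real (24 * pi\<^sup>2) * (k\<^sup>2 * E)\<^sup>2)) / 2 = - (X * n) / (48 * (of_real pi)\<^sup>2 * (k ^ 4 * E\<^sup>2))" for X n k
    by (simp add: power_mult_distrib flip: power_mult)
  then have "(of_real (\<xi> * c))\<^sup>2 * kernel_reg c s B e 0 / 2 =
      - ((of_real (\<xi> * c))\<^sup>2 * (B * of_real c ^ 4 - e * of_real s ^ 4)) / (48 * (of_real pi)\<^sup>2 * (of_real c ^ 4 * E\<^sup>2))"
    unfolding kernel_reg_0 lead by blast
  also have "(of_real (\<xi> * c))\<^sup>2 * (B * of_real c ^ 4 - e * of_real s ^ 4) =
      of_real c ^ 4 * (B * (of_real (\<xi> * c))\<^sup>2 - (of_real r)\<^sup>2 * of_real (\<xi> * s) ^ 4)"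
    by (simp add: e_def algebra_simps power_mult_distrib)
  also have "- (of_real c ^ 4 * (B * (of_real (\<xi> * c))\<^sup>2 - (of_real r)\<^sup>2 * of_real (\<xi> * s) ^ 4)) / (48 * (of_real pi)\<^sup>2 * (of_real c ^ 4 * E\<^sup>2))
      = ((of_real r)\<^sup>2 * of_real (\<xi> * s) ^ 4 - B * (of_real (\<xi> * c))\<^sup>2) / (48 * (of_real pi)\<^sup>2 * E\<^sup>2)"
    using nz by (simp add: divide_simps)
  finally have "(of_real (\<xi> * c))\<^sup>2 * kernel_reg c s B e 0 / 2 = ((of_real r)\<^sup>2 * of_real (\<xi> * s) ^ 4 - B * (of_real (\<xi> * c))\<^sup>2) / (48 * (of_real pi)\<^sup>2 * E\<^sup>2)" .
  moreover have "(of_real c)\<^sup>2 / (12 * kernel_lead c s B e) = 1 / (12 * E)"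
    unfolding lead using nz by simp
  ultimately show ?thesis
    unfolding A_fun_def B_def[symmetric] E_def[symmetric] by (simp only:)
qed

text \<open>With |\<xi>| and a two-sided punctured limit, the expansions for \<xi> > 0 and \<xi> < 0
  are restrictions of a single estimate.\<close>

lemma Psi_asymptotics:
  fixes T0 r t z \<theta> :: real
  assumes T0: "T0 > 0" and c: "cos \<theta> \<noteq> 0"
  defines "I \<equiv> I_fun T0 r t z \<theta>"
  obtains K where
   "\<forall>\<^sub>F \<xi> in at 0.
        (\<forall>n\<ge>1. Psi_denom T0 r t z (\<xi> * cos \<theta>) (\<xi> * sin \<theta>) n \<noteq> 0)
        \<and> summable (\<lambda>n. Psi_term T0 r t z (\<xi> * cos \<theta>) (\<xi> * sin \<theta>) (Suc n))
        \<and> (\<forall>y>0. I_denom1 T0 r t z \<theta> \<xi> y \<noteq> 0) \<and> I_denom2 T0 r t z \<theta> \<xi> \<noteq> 0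
        \<and> set_integrable lborel {0<..} (I_integrand T0 r t z \<theta> \<xi>)"
   "\<And>N. \<forall>\<^sub>F \<xi> in at 0. norm (Psi T0 r t z (\<xi> * cos \<theta>) (\<xi> * sin \<theta>)
        - (A_real T0 r t z (\<xi> * cos \<theta>) (\<xi> * sin \<theta>) + of_real (\<bar>\<xi>\<bar> * (cos \<theta>)\<^sup>2) * I \<xi>)) \<le> K N * \<bar>\<xi>\<bar> ^ N"
proof -
  define C S where "C = cos \<theta>" and "S = sin \<theta>"
  have C: "C \<noteq> 0" "\<bar>C\<bar> \<le> 1" and S: "\<bar>S\<bar> \<le> 1" using c by (auto simp: C_def S_def)
  define \<beta> where "\<beta> = 1 / T0\<^sup>2"
  have \<beta>: "\<beta> > 0" using T0 by (simp add: \<beta>_def)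
  from kernel_bounds[OF C S \<beta>] obtain M e0 where e0: "e0 > 0"
    and kb: "\<forall>B e. norm (B - of_real \<beta>) \<le> \<beta> / 2 \<longrightarrow> norm e \<le> e0 \<longrightarrow>
       kernel_lead C S B e \<noteq> 0 \<and>
       (\<forall>w\<in>unit_strip - {0}. kernel_den C S B e w \<noteq> 0) \<and>
       kernel_reg C S B e holomorphic_on unit_strip \<and>
       (\<forall>w\<in>unit_strip. norm (kernel_reg C S B e w) \<le> M / (1 + (Re w)\<^sup>2))"
    by (elim exE conjE)
  define B where "B = (\<lambda>\<xi>. B_fun T0 t z (of_real (\<xi> * C)))"
  define e where "e = (\<lambda>\<xi>. complex_of_real ((\<xi> * C)\<^sup>2 * r\<^sup>2))"
  define h where "h = (\<lambda>\<xi>. kernel_reg C S (B \<xi>) (e \<xi>))"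
  define L where "L = (\<lambda>\<xi>. kernel_lead C S (B \<xi>) (e \<xi>))"
  \<comment> \<open>The conditions of \<open>kernel_bounds\<close>, met for small \<xi> since B(0) =
    1/T0^2 and e(0) = 0, together with the mesh condition |\<xi>| \<le> 1 of the trapezoidal
    estimate.\<close>
  define good where "good = (\<lambda>\<xi>::real. \<xi> \<noteq> 0 \<and> \<bar>\<xi>\<bar> \<le> 1 \<and> norm (B \<xi> - of_real \<beta>) \<le> \<beta> / 2 \<and> norm (e \<xi>) \<le> e0)"
  have ev: "\<forall>\<^sub>F \<xi> in at 0. good \<xi>"
  proof -
    have "((\<lambda>\<xi>. norm (B \<xi> - of_real \<beta>)) \<longlongrightarrow> norm (B 0 - of_real \<beta>)) (at 0)"
      unfolding B_def B_fun_def by (intro tendsto_intros)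
    moreover have "B 0 = of_real \<beta>" by (simp add: B_def B_fun_def \<beta>_def power_divide)
    ultimately have 1: "\<forall>\<^sub>F \<xi> in at 0. norm (B \<xi> - of_real \<beta>) < \<beta> / 2"
      using \<beta> by (intro order_tendstoD(2)) auto
    have "((\<lambda>\<xi>. norm (e \<xi>)) \<longlongrightarrow> norm (e 0)) (at 0)"
      unfolding e_def by (intro tendsto_intros)
    then have 2: "\<forall>\<^sub>F \<xi> in at 0. norm (e \<xi>) < e0"
      using e0 by (intro order_tendstoD(2)) (auto simp: e_def)
    have 3: "\<forall>\<^sub>F \<xi>::real in at 0. \<bar>\<xi>\<bar> < 1"
      by (auto simp: eventually_at intro!: exI[of _ 1])
    show ?thesis
      using 1 2 3 eventually_neq_at_within[of "0::real" "0::real" UNIV] unfolding good_def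
      by eventually_elim auto
  qed
  define \<kappa> where "\<kappa> = (\<Sum>n. 1 / (1 + (real n)\<^sup>2))"
  \<comment> \<open>The absolute value gives nonnegativity without an argument about the sign of
    M.\<close>
  define K where "K = (\<lambda>N. \<bar>C\<^sup>2 / 2 * (18 * M * \<kappa> * fact (N + 3) * 2 ^ (N + 3))\<bar>)"
  have real_in: "complex_of_real x \<in> unit_strip" for x by (simp add: unit_strip_def)
  have main: "(\<forall>n\<ge>1. Psi_denom T0 r t z (\<xi> * C) (\<xi> * S) n \<noteq> 0)
        \<and> summable (\<lambda>n. Psi_term T0 r t z (\<xi> * C) (\<xi> * S) (Suc n))
        \<and> (\<forall>y>0. I_denom1 T0 r t z \<theta> \<xi> y \<noteq> 0) \<and> I_denom2 T0 r t z \<theta> \<xi> \<noteq> 0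
        \<and> set_integrable lborel {0<..} (I_integrand T0 r t z \<theta> \<xi>)
        \<and> (\<forall>N. norm (Psi T0 r t z (\<xi> * C) (\<xi> * S)
           - (A_real T0 r t z (\<xi> * C) (\<xi> * S) + of_real (\<bar>\<xi>\<bar> * C\<^sup>2) * I \<xi>)) \<le> K N * \<bar>\<xi>\<bar> ^ N)"
    if good: "good \<xi>" for \<xi>
  proof -
    define \<tau> where "\<tau> = \<bar>\<xi>\<bar>"
    have \<tau>: "0 < \<tau>" "\<tau> \<le> 1" and \<xi>2: "\<tau>\<^sup>2 = \<xi>\<^sup>2" using good by (auto simp: good_def \<tau>_def)
    have k: "L \<xi> \<noteq> 0" "\<And>w. w \<in> unit_strip - {0} \<Longrightarrow> kernel_den C S (B \<xi>) (e \<xi>) w \<noteq> 0"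
      "h \<xi> holomorphic_on unit_strip" "\<And>w. w \<in> unit_strip \<Longrightarrow> norm (h \<xi> w) \<le> M / (1 + (Re w)\<^sup>2)"
      using kb[THEN spec, THEN spec, THEN mp, THEN mp, of "B \<xi>" "e \<xi>"] good
      by (simp_all add: good_def L_def h_def)
    have den: "Psi_denom T0 r t z (\<xi> * C) (\<xi> * S) n = kernel_den C S (B \<xi>) (e \<xi>) (of_real (real n * \<tau>))" for n
      unfolding Psi_denom_eq_kernel B_def e_def \<tau>_def ..
    have den1: "I_denom1 T0 r t z \<theta> \<xi> y = kernel_den C S (B \<xi>) (e \<xi>) (of_real y)" for y
      unfolding I_denom1_eq_kernel B_def e_def C_def S_def ..
    have den2: "I_denom2 T0 r t z \<theta> \<xi> = L \<xi>"
      unfolding I_denom2_eq_kernel B_def e_def L_def C_def S_def ..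
    have den_nz: "kernel_den C S (B \<xi>) (e \<xi>) (of_real x) \<noteq> 0" if "x \<noteq> 0" for x
      using k(2)[of "of_real x"] real_in that by simp
    have h_eq: "h \<xi> (of_real x) = 1 / (of_real (8 * pi\<^sup>2) * kernel_den C S (B \<xi>) (e \<xi>) (of_real x))
        - 1 / (of_real (2 * pi\<^sup>2) * (of_real x)\<^sup>2 * L \<xi>)" if "x \<noteq> 0" for x
      unfolding h_def L_def by (rule kernel_reg_eq) (use that den_nz k(1) in \<open>auto simp: L_def\<close>)
    have integrand: "I_integrand T0 r t z \<theta> \<xi> y = h \<xi> (of_real y)" if "y > 0" for y
      unfolding I_integrand_def den1 den2 using h_eq[of y] that by simp
    have even: "h \<xi> (- w) = h \<xi> w" for w by (simp add: h_def kernel_reg_even)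
    note trap = strip_sum_integral_bound[OF k(3,4) even \<tau>]
    have I_eq: "I \<xi> = (LBINT y:{0<..}. h \<xi> (of_real y))"
      unfolding I_def I_fun_def by (intro set_lebesgue_integral_cong) (auto simp: integrand)
    define H where "H = (\<Sum>n. h \<xi> (of_real (real (Suc n) * \<tau>)))"
    \<comment> \<open>Each term splits into \<tau>^2 C^2 h(n \<tau>) and C^2 / (2 \<pi>^2 L n^2);
      the mesh cancels in the latter, whose sum is C^2 / (12 L) by the value of \<zeta>(2).\<close>
    have sums: "(\<lambda>n. 1 / of_real (8 * pi\<^sup>2) * Psi_term T0 r t z (\<xi> * C) (\<xi> * S) (Suc n)) sums
        (of_real (\<tau>\<^sup>2 * C\<^sup>2) * H + (of_real C)\<^sup>2 / (12 * L \<xi>))"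
    proof -
      have "(\<lambda>n. complex_of_real (1 / (real n + 1)\<^sup>2)) sums of_real (pi\<^sup>2 / 6)"
        using inverse_squares_sums by (subst sums_of_real_iff) (simp add: add.commute)
      from sums_mult[OF this, of "(of_real C)\<^sup>2 / (2 * of_real (pi\<^sup>2) * L \<xi>)"]
      have "(\<lambda>n. (of_real C)\<^sup>2 / (2 * of_real (pi\<^sup>2) * L \<xi>) * of_real (1 / (real n + 1)\<^sup>2)) sums ((of_real C)\<^sup>2 / (12 * L \<xi>))"
        by simp
      moreover have "(\<lambda>n. of_real (\<tau>\<^sup>2 * C\<^sup>2) * h \<xi> (of_real (real (Suc n) * \<tau>))) sums (of_real (\<tau>\<^sup>2 * C\<^sup>2) * H)"
        unfolding H_def by (intro sums_mult summable_sums trap(2))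
      ultimately have "(\<lambda>n. of_real (\<tau>\<^sup>2 * C\<^sup>2) * h \<xi> (of_real (real (Suc n) * \<tau>))
          + (of_real C)\<^sup>2 / (2 * of_real (pi\<^sup>2) * L \<xi>) * of_real (1 / (real n + 1)\<^sup>2)) sums
          (of_real (\<tau>\<^sup>2 * C\<^sup>2) * H + (of_real C)\<^sup>2 / (12 * L \<xi>))"
        by (intro sums_add)
      moreover have "of_real (\<tau>\<^sup>2 * C\<^sup>2) * h \<xi> (of_real (real (Suc n) * \<tau>))
          + (of_real C)\<^sup>2 / (2 * of_real (pi\<^sup>2) * L \<xi>) * of_real (1 / (real n + 1)\<^sup>2) =
          1 / of_real (8 * pi\<^sup>2) * Psi_term T0 r t z (\<xi> * C) (\<xi> * S) (Suc n)" for n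
      proof -
        define x where "x = real (Suc n) * \<tau>"
        have x: "x \<noteq> 0" using \<tau> by (simp add: x_def del: of_nat_Suc)
        define d where "d = kernel_den C S (B \<xi>) (e \<xi>) (of_real x)"
        have "1 / of_real (8 * pi\<^sup>2) * Psi_term T0 r t z (\<xi> * C) (\<xi> * S) (Suc n) =
            of_real (\<tau>\<^sup>2 * C\<^sup>2) * (1 / (of_real (8 * pi\<^sup>2) * d))"
          unfolding Psi_term_def den d_def x_def \<xi>2 by (simp add: power_mult_distrib)
        also have "1 / (of_real (8 * pi\<^sup>2) * d) = h \<xi> (of_real x) + 1 / (of_real (2 * pi\<^sup>2) * (of_real x)\<^sup>2 * L \<xi>)"
          unfolding h_eq[OF x] d_def by simp
        also have "of_real (\<tau>\<^sup>2 * C\<^sup>2) * \<dots> = of_real (\<tau>\<^sup>2 * C\<^sup>2) * h \<xi> (of_real x)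
            + of_real (\<tau>\<^sup>2 * C\<^sup>2) / (of_real (2 * pi\<^sup>2) * (of_real x)\<^sup>2 * L \<xi>)"
          by (simp add: distrib_left)
        also have "of_real (\<tau>\<^sup>2 * C\<^sup>2) / (of_real (2 * pi\<^sup>2) * (of_real x)\<^sup>2 * L \<xi>) =
            (of_real C)\<^sup>2 / (2 * of_real (pi\<^sup>2) * L \<xi>) * of_real (1 / (real n + 1)\<^sup>2)"
          using \<tau> by (simp add: x_def power_mult_distrib add.commute)
        finally show ?thesis by (simp add: x_def)
      qed
      ultimately show ?thesis by simp
    qed
    have summ: "summable (\<lambda>n. Psi_term T0 r t z (\<xi> * C) (\<xi> * S) (Suc n))"
    proof -
      have "summable (\<lambda>n. of_real (8 * pi\<^sup>2) * (1 / of_real (8 * pi\<^sup>2) * Psi_term T0 r t z (\<xi> * C) (\<xi> * S) (Suc n)))"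
        by (rule summable_mult[OF sums_summable[OF sums]])
      then show ?thesis by simp
    qed
    have Psi_eq: "Psi T0 r t z (\<xi> * C) (\<xi> * S) = of_real (\<tau>\<^sup>2 * C\<^sup>2) * H + (of_real C)\<^sup>2 / (12 * L \<xi>)"
      unfolding Psi_def using sums_unique[OF sums] suminf_mult[OF summ, of "1 / of_real (8 * pi\<^sup>2)"] by simp
    have A_eq: "A_real T0 r t z (\<xi> * C) (\<xi> * S) = (of_real C)\<^sup>2 / (12 * L \<xi>) - of_real (\<tau>\<^sup>2 * C\<^sup>2) * h \<xi> 0 / 2"
      unfolding L_def h_def \<xi>2 using A_real_eq_kernel[of C S T0 t z \<xi> r] C k(1)
      by (simp add: L_def B_def e_def power_mult_distrib)
    have "norm (Psi T0 r t z (\<xi> * C) (\<xi> * S)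
           - (A_real T0 r t z (\<xi> * C) (\<xi> * S) + of_real (\<bar>\<xi>\<bar> * C\<^sup>2) * I \<xi>)) \<le> K N * \<bar>\<xi>\<bar> ^ N" for N
    proof -
      \<comment> \<open>The endpoint term of A completes the sum over n \<ge> 1 to the trapezoidal
        sum with h(0)/2, doubled here.\<close>
      have "Psi T0 r t z (\<xi> * C) (\<xi> * S) - (A_real T0 r t z (\<xi> * C) (\<xi> * S) + of_real (\<bar>\<xi>\<bar> * C\<^sup>2) * I \<xi>) =
          of_real (\<tau> * C\<^sup>2 / 2) * (of_real \<tau> * (h \<xi> 0 + 2 * H) - 2 * I \<xi>)"
        unfolding Psi_eq A_eq \<tau>_def[symmetric] by (simp add: field_simps power2_eq_square)
      then have "norm (Psi T0 r t z (\<xi> * C) (\<xi> * S) - (A_real T0 r t z (\<xi> * C) (\<xi> * S) + of_real (\<bar>\<xi>\<bar> * C\<^sup>2) * I \<xi>)) =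
          \<tau> * C\<^sup>2 / 2 * norm (of_real \<tau> * (h \<xi> 0 + 2 * H) - 2 * I \<xi>)"
        using \<tau> by (simp only: norm_mult norm_of_real) simp
      also have "\<dots> \<le> \<tau> * C\<^sup>2 / 2 * (18 * M * \<kappa> * fact (N + 3) * 2 ^ (N + 3) * \<tau> ^ (N + 2))"
        using trap(3)[of N] \<tau> unfolding I_eq H_def \<kappa>_def by (intro mult_left_mono) auto
      also have "\<dots> = C\<^sup>2 / 2 * (18 * M * \<kappa> * fact (N + 3) * 2 ^ (N + 3)) * \<tau> ^ (N + 3)"
        by (simp add: power_add eval_nat_numeral)
      also have "\<dots> \<le> K N * \<tau> ^ (N + 3)"
        unfolding K_def using \<tau> by (intro mult_right_mono) auto
      also have "\<dots> \<le> K N * \<tau> ^ N"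
        using \<tau> by (intro mult_left_mono power_decreasing) (auto simp: K_def)
      finally show ?thesis by (simp add: \<tau>_def)
    qed
    moreover have "set_integrable lborel {0<..} (I_integrand T0 r t z \<theta> \<xi>)"
      using trap(1) by (subst set_integrable_cong[OF refl refl]) (auto simp: integrand)
    moreover have "Psi_denom T0 r t z (\<xi> * C) (\<xi> * S) n \<noteq> 0" if "n \<ge> 1" for n
      unfolding den using \<tau> that by (intro den_nz) simp
    ultimately show ?thesis
      using summ den_nz k(1) by (auto simp: den1 den2)
  qed
  show thesis
  proof (rule that)
    show "\<forall>\<^sub>F \<xi> in at 0.
        (\<forall>n\<ge>1. Psi_denom T0 r t z (\<xi> * cos \<theta>) (\<xi> * sin \<theta>) n \<noteq> 0)
        \<and> summable (\<lambda>n. Psi_term T0 r t z (\<xi> * cos \<theta>) (\<xi> * sin \<theta>) (Suc n))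
        \<and> (\<forall>y>0. I_denom1 T0 r t z \<theta> \<xi> y \<noteq> 0) \<and> I_denom2 T0 r t z \<theta> \<xi> \<noteq> 0
        \<and> set_integrable lborel {0<..} (I_integrand T0 r t z \<theta> \<xi>)"
      by (rule eventually_mono[OF ev]) (use main in \<open>unfold C_def S_def, blast\<close>)
    show "\<forall>\<^sub>F \<xi> in at 0. norm (Psi T0 r t z (\<xi> * cos \<theta>) (\<xi> * sin \<theta>)
        - (A_real T0 r t z (\<xi> * cos \<theta>) (\<xi> * sin \<theta>) + of_real (\<bar>\<xi>\<bar> * (cos \<theta>)\<^sup>2) * I \<xi>)) \<le> K N * \<bar>\<xi>\<bar> ^ N" for N
      by (rule eventually_mono[OF ev]) (use main in \<open>unfold C_def S_def, blast\<close>)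
  qed
qed

section \<open>Real acceleration and angular velocity\<close>

text \<open>At imaginary arguments i^2 = -1 and i^4 = 1 make B and the denominator real, and the
  minus sign in r^2 \<phi>^4 - B \<Phi>^2 becomes the plus sign in E.\<close>

lemma A_fun_imaginary:
  fixes T0 r t z a \<omega> :: real
  assumes T0: "T0 > 0"
  defines "D \<equiv> (1 + a * z)\<^sup>2 - a\<^sup>2 * t\<^sup>2 - r\<^sup>2 * \<omega>\<^sup>2"
    and "E \<equiv> a\<^sup>2 * ((1 + a * z)\<^sup>2 - a\<^sup>2 * t\<^sup>2) + r\<^sup>2 * \<omega> ^ 4"
  assumes D: "D \<noteq> 0"
  shows "(\<i> * of_real (a / T0), \<i> * of_real (\<omega> / T0)) \<in> A_dom T0 r t z"
    and "A_fun T0 r t z (\<i> * of_real (a / T0)) (\<i> * of_real (\<omega> / T0)) = of_real (T0\<^sup>2 / (12 * D) - E / (48 * pi\<^sup>2 * D\<^sup>2))"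
proof -
  define b where "b = ((1 + a * z)\<^sup>2 - a\<^sup>2 * t\<^sup>2) / T0\<^sup>2"
  have B: "B_fun T0 t z (\<i> * of_real (a / T0)) = of_real b"
  proof -
    have "B_fun T0 t z (\<i> * of_real (a / T0)) = of_real (- (t\<^sup>2 * (a / T0)\<^sup>2) + (1 / T0 + a / T0 * z)\<^sup>2)"
      by (simp add: B_fun_def power_mult_distrib power_divide)
    also have "- (t\<^sup>2 * (a / T0)\<^sup>2) + (1 / T0 + a / T0 * z)\<^sup>2 = b"
      using T0 by (simp add: b_def power2_eq_square field_simps)
    finally show ?thesis .
  qed
  have den: "B_fun T0 t z (\<i> * of_real (a / T0)) + (of_real r)\<^sup>2 * (\<i> * of_real (\<omega> / T0))\<^sup>2 = of_real (D / T0\<^sup>2)"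
    unfolding B by (simp add: b_def D_def power_mult_distrib power_divide diff_divide_distrib)
  show "(\<i> * of_real (a / T0), \<i> * of_real (\<omega> / T0)) \<in> A_dom T0 r t z"
    unfolding A_dom_def A_den_def mem_Collect_eq fst_conv snd_conv den using D T0 by simp
  have i_pow: "(\<i> * of_real u) ^ 4 = of_real (u ^ 4)" "(\<i> * of_real u)\<^sup>2 = of_real (- u\<^sup>2)" for u
    by (simp_all add: power_mult_distrib)
  have "A_fun T0 r t z (\<i> * of_real (a / T0)) (\<i> * of_real (\<omega> / T0)) =
      of_real (1 / (12 * (D / T0\<^sup>2)) - (r\<^sup>2 * (\<omega> / T0) ^ 4 + b * (a / T0)\<^sup>2) / (48 * pi\<^sup>2 * (D / T0\<^sup>2)\<^sup>2))"
    unfolding A_fun_def den unfolding B i_pow by simp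
  also have "r\<^sup>2 * (\<omega> / T0) ^ 4 + b * (a / T0)\<^sup>2 = E / T0 ^ 4"
    using T0 by (simp add: b_def E_def field_simps eval_nat_numeral)
  also have "1 / (12 * (D / T0\<^sup>2)) - E / T0 ^ 4 / (48 * pi\<^sup>2 * (D / T0\<^sup>2)\<^sup>2) = T0\<^sup>2 / (12 * D) - E / (48 * pi\<^sup>2 * D\<^sup>2)"
    using T0 D by (simp add: power_divide flip: power_mult)
  finally show "A_fun T0 r t z (\<i> * of_real (a / T0)) (\<i> * of_real (\<omega> / T0)) = of_real (T0\<^sup>2 / (12 * D) - E / (48 * pi\<^sup>2 * D\<^sup>2))" .
qed

theorem mainTheorem12:
  fixes T0 r t z \<theta> :: real
  assumes "T0 > 0" and "r \<ge> 0" and "cos \<theta> \<noteq> 0"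
  shows
    "(\<forall>\<^sub>F \<xi> in at 0.
        (\<forall>n\<ge>1. Psi_denom T0 r t z (\<xi> * cos \<theta>) (\<xi> * sin \<theta>) n \<noteq> 0)
        \<and> summable (\<lambda>n. Psi_term T0 r t z (\<xi> * cos \<theta>) (\<xi> * sin \<theta>) (Suc n))
        \<and> (\<forall>y>0. I_denom1 T0 r t z \<theta> \<xi> y \<noteq> 0) \<and> I_denom2 T0 r t z \<theta> \<xi> \<noteq> 0
        \<and> set_integrable lborel {0<..} (I_integrand T0 r t z \<theta> \<xi>))
     \<and> (\<forall>N::nat.
          (\<lambda>\<xi>. Psi T0 r t z (\<xi> * cos \<theta>) (\<xi> * sin \<theta>)
                - (A_real T0 r t z (\<xi> * cos \<theta>) (\<xi> * sin \<theta>)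
                   + of_real (\<xi> * (cos \<theta>)\<^sup>2) * I_fun T0 r t z \<theta> \<xi>))
            \<in> O[at_right 0](\<lambda>\<xi>. complex_of_real (\<bar>\<xi>\<bar> ^ N))
        \<and> (\<lambda>\<xi>. Psi T0 r t z (\<xi> * cos \<theta>) (\<xi> * sin \<theta>)
                - (A_real T0 r t z (\<xi> * cos \<theta>) (\<xi> * sin \<theta>)
                   - of_real (\<xi> * (cos \<theta>)\<^sup>2) * I_fun T0 r t z \<theta> \<xi>))
            \<in> O[at_left 0](\<lambda>\<xi>. complex_of_real (\<bar>\<xi>\<bar> ^ N)))
     \<and> (\<exists>U. open U \<and> (0, 0) \<in> U
            \<and> (\<forall>(\<Phi>, \<phi>)\<in>U. B_fun T0 t z \<Phi> + (of_real r)\<^sup>2 * \<phi>\<^sup>2 \<noteq> 0)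
            \<and> analytic2_on (\<lambda>(\<Phi>, \<phi>). A_fun T0 r t z \<Phi> \<phi>) U)
     \<and> (\<forall>a \<omega> x y :: real.
          (1 + a * z)\<^sup>2 - a\<^sup>2 * t\<^sup>2 - r\<^sup>2 * \<omega>\<^sup>2 > 0 \<longrightarrow> r\<^sup>2 = x\<^sup>2 + y\<^sup>2 \<longrightarrow>
          (let D = (1 + a * z)\<^sup>2 - a\<^sup>2 * t\<^sup>2 - r\<^sup>2 * \<omega>\<^sup>2;
               E = a\<^sup>2 * ((1 + a * z)\<^sup>2 - a\<^sup>2 * t\<^sup>2) + r\<^sup>2 * \<omega> ^ 4;
               X = vec4 t x y z;
               \<beta>2 = lorentz_sq (four_temp T0 a \<omega> X);
               \<alpha>2 = lorentz_sq (alpha_vec T0 a \<omega> X)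
           in (\<exists>!v. continuation_value (A_real T0 r t z)
                      (\<i> * of_real (a / T0), \<i> * of_real (\<omega> / T0)) v)
              \<and> psi_sq T0 r t z a \<omega> = of_real (T0\<^sup>2 / (12 * D) - E / (48 * pi\<^sup>2 * D\<^sup>2))
              \<and> psi_sq T0 r t z a \<omega> = of_real (1 / (12 * \<beta>2) + \<alpha>2 / (48 * pi\<^sup>2 * \<beta>2))
              \<and> \<beta>2 = D / T0\<^sup>2
              \<and> \<alpha>2 = - E / (\<beta>2 * T0 ^ 4)))"
  (is "?regular \<and> (\<forall>N. ?right N \<and> ?left N) \<and> ?analytic \<and> (\<forall>a \<omega> x y. ?thermal a \<omega> x y)")
proof (intro conjI allI)
  have T0: "T0 \<noteq> 0" using assms(1) by simp
  obtain K where ev: ?regular and K: "\<And>N. \<forall>\<^sub>F \<xi> in at 0. norm (Psi T0 r t z (\<xi> * cos \<theta>) (\<xi> * sin \<theta>)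
        - (A_real T0 r t z (\<xi> * cos \<theta>) (\<xi> * sin \<theta>) + of_real (\<bar>\<xi>\<bar> * (cos \<theta>)\<^sup>2) * I_fun T0 r t z \<theta> \<xi>)) \<le> K N * \<bar>\<xi>\<bar> ^ N"
    using Psi_asymptotics[OF assms(1,3), of r t z] by blast
  show ?regular by (rule ev)
  show "?right N" for N
  proof (rule bigoI[where c = "K N"])
    have "\<forall>\<^sub>F \<xi> in at_right (0::real). \<xi> > 0" by (rule eventually_at_right_less)
    then show "\<forall>\<^sub>F \<xi> in at_right 0. norm (Psi T0 r t z (\<xi> * cos \<theta>) (\<xi> * sin \<theta>)
        - (A_real T0 r t z (\<xi> * cos \<theta>) (\<xi> * sin \<theta>) + of_real (\<xi> * (cos \<theta>)\<^sup>2) * I_fun T0 r t z \<theta> \<xi>))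
        \<le> K N * norm (complex_of_real (\<bar>\<xi>\<bar> ^ N))"
      using filter_leD[OF at_le[OF subset_UNIV] K[of N]]
      by eventually_elim (simp add: norm_power)
  qed
  show "?left N" for N
  proof (rule bigoI[where c = "K N"])
    have "\<forall>\<^sub>F \<xi> in at_left (0::real). \<xi> < 0"
      by (auto simp: eventually_at intro: exI[of _ 1])
    then show "\<forall>\<^sub>F \<xi> in at_left 0. norm (Psi T0 r t z (\<xi> * cos \<theta>) (\<xi> * sin \<theta>)
        - (A_real T0 r t z (\<xi> * cos \<theta>) (\<xi> * sin \<theta>) - of_real (\<xi> * (cos \<theta>)\<^sup>2) * I_fun T0 r t z \<theta> \<xi>))
        \<le> K N * norm (complex_of_real (\<bar>\<xi>\<bar> ^ N))"
      using filter_leD[OF at_le[OF subset_UNIV] K[of N]]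
      by eventually_elim (simp add: norm_power power_abs)
  qed
  show ?analytic
    by (intro exI[of _ "A_dom T0 r t z"] conjI open_A_dom zero_in_A_dom T0 A_fun_analytic)
       (auto simp: A_dom_def A_den_def)
  show "?thermal a \<omega> x y" for a \<omega> x y
  proof (intro impI)
    assume D: "(1 + a * z)\<^sup>2 - a\<^sup>2 * t\<^sup>2 - r\<^sup>2 * \<omega>\<^sup>2 > 0" and xy: "r\<^sup>2 = x\<^sup>2 + y\<^sup>2"
    define D E where "D = (1 + a * z)\<^sup>2 - a\<^sup>2 * t\<^sup>2 - r\<^sup>2 * \<omega>\<^sup>2"
      and "E = a\<^sup>2 * ((1 + a * z)\<^sup>2 - a\<^sup>2 * t\<^sup>2) + r\<^sup>2 * \<omega> ^ 4"
    define \<beta>2 \<alpha>2 where "\<beta>2 = lorentz_sq (four_temp T0 a \<omega> (vec4 t x y z))"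
      and "\<alpha>2 = lorentz_sq (alpha_vec T0 a \<omega> (vec4 t x y z))"
    define p where "p = (\<i> * complex_of_real (a / T0), \<i> * complex_of_real (\<omega> / T0))"
    have D0: "D > 0" using D by (simp add: D_def)
    have \<beta>2: "\<beta>2 = D / T0\<^sup>2" unfolding \<beta>2_def D_def four_temp_lorentz_sq xy ..
    then have "\<beta>2 > 0" using D0 T0 by simp
    then have \<alpha>2: "\<alpha>2 = - E / (\<beta>2 * T0 ^ 4)"
      unfolding \<alpha>2_def \<beta>2_def E_def xy by (rule alpha_vec_lorentz_sq)
    have p: "p \<in> A_dom T0 r t z"
      and val: "A_fun T0 r t z (fst p) (snd p) = of_real (T0\<^sup>2 / (12 * D) - E / (48 * pi\<^sup>2 * D\<^sup>2))"
      using A_fun_imaginary[OF assms(1), of a z t r \<omega>] D0 by (simp_all add: p_def D_def E_def)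
    \<comment> \<open>Existence and uniqueness together make the definite description in
      \<open>psi_sq\<close> evaluate to A at p.\<close>
    have cont: "continuation_value (A_real T0 r t z) p v \<longleftrightarrow> v = A_fun T0 r t z (fst p) (snd p)" for v
      using continuation_value_A_fun[OF T0 p] continuation_value_unique[OF T0 p] by blast
    have psi: "psi_sq T0 r t z a \<omega> = of_real (T0\<^sup>2 / (12 * D) - E / (48 * pi\<^sup>2 * D\<^sup>2))"
      unfolding psi_sq_def p_def[symmetric] cont val by simp
    have eq: "T0\<^sup>2 / (12 * D) - E / (48 * pi\<^sup>2 * D\<^sup>2) = 1 / (12 * \<beta>2) + \<alpha>2 / (48 * pi\<^sup>2 * \<beta>2)"
      unfolding \<alpha>2 unfolding \<beta>2 using T0 D0 by (simp add: power2_eq_square power4_eq_xxxx)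
    have ex1: "\<exists>!v. continuation_value (A_real T0 r t z) p v" unfolding cont by simp
    show "let D = (1 + a * z)\<^sup>2 - a\<^sup>2 * t\<^sup>2 - r\<^sup>2 * \<omega>\<^sup>2;
               E = a\<^sup>2 * ((1 + a * z)\<^sup>2 - a\<^sup>2 * t\<^sup>2) + r\<^sup>2 * \<omega> ^ 4;
               X = vec4 t x y z;
               \<beta>2 = lorentz_sq (four_temp T0 a \<omega> X);
               \<alpha>2 = lorentz_sq (alpha_vec T0 a \<omega> X)
           in (\<exists>!v. continuation_value (A_real T0 r t z)
                      (\<i> * of_real (a / T0), \<i> * of_real (\<omega> / T0)) v)
              \<and> psi_sq T0 r t z a \<omega> = of_real (T0\<^sup>2 / (12 * D) - E / (48 * pi\<^sup>2 * D\<^sup>2))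
              \<and> psi_sq T0 r t z a \<omega> = of_real (1 / (12 * \<beta>2) + \<alpha>2 / (48 * pi\<^sup>2 * \<beta>2))
              \<and> \<beta>2 = D / T0\<^sup>2
              \<and> \<alpha>2 = - E / (\<beta>2 * T0 ^ 4)"
      unfolding Let_def
      unfolding D_def[symmetric] E_def[symmetric] \<beta>2_def[symmetric] \<alpha>2_def[symmetric] p_def[symmetric]
      using ex1 psi psi[unfolded eq] \<beta>2 \<alpha>2 by (intro conjI)
  qed
qed

end
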